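(* Let $\mathcal F_3$ and $\mathcal F_9$ be alternative sets of OPFs on $\mathbb C^3$ and $\mathbb C^9=\mathbb C^3\otimes\mathbb C^3$, with a bilinear product $\star:\mathcal F_3\times\mathcal F_3\to\mathcal F_9$, satisfying the consistency constraints C1, C2, C3 and the Finiteness Principle. Then local tomography is violated: if $\{F_a\}_a$ is a basis of the real span of $\mathcal F_3$, then $\{F_a\star F_b\}_{a,b}$ is not a basis of the real span of $\mathcal F_9$.
   Context: Pure states of $\mathbb C^d$ are rays (unit vectors up to phase); reversible transformations are $\psi\mapsto U\psi$, $U\in\mathrm{SU}(d)$; pure states of the composite of $\mathbb C^{d_{\sf A}}$ and $\mathbb C^{d_{\sf B}}$ are rays of $\mathbb C^{d_{\sf A}}\otimes\mathbb C^{d_{\sf B}}$. An OPF on $\mathbb C^d$ is a function $F$ from rays to $[0,1]$; $\mathcal F_d$ is a set of OPFs containing the unit OPF ${\bf u}\equiv 1$. Constraints: (C1) for every $F\in\mathcal F_d$, $U\in\mathrm{SU}(d)$ there is $F'\in\mathcal F_d$ with $F'(\psi)=F(U\psi)$ for all $\psi$; (C2) distinct rays are separated by some $F\in\mathcal F_d$; (C3) ${\bf u}\star{\bf u}={\bf u}$ and $(F_{\sf A}\star F_{\sf B})(\psi_{\sf A}\otimes\phi_{\sf B})=F_{\sf A}(\psi_{\sf A})F_{\sf B}(\phi_{\sf B})$. Finiteness Principle: the real vector space spanned by $\mathcal F_d$ (as real-valued functions on rays) is finite-dimensional. A set $\mathcal F_d$ is alternative if it contains an OPF not of the Born form $F(\psi)=\mathrm{tr}(\hat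 F|\psi\rangle\langle\psi|)$ with $\hat F$ Hermitian (i.e. it is neither quantum nor a restriction of quantum). *)

theory Defs
  imports "HOL-Analysis.Analysis" "HOL-Library.Function_Algebras"
begin

definition proj :: "complex^'n \<Rightarrow> complex^'n^'n" where
  "proj \<psi> = (\<chi> i j. \<psi>$i * cnj (\<psi>$j))"

text \<open>A ray (unit vector up to phase) is represented by its rank-one projector.\<close>
typedef 'n ray = "{proj \<psi> | \<psi> :: complex^'n. norm \<psi> = 1}"
proof -
  obtain i :: 'n where True by simp
  have e: "(\<lambda>j. (norm ((axis i (1::complex))$j))\<^sup>2) = (\<lambda>j. if j = i then 1 else 0)"
    by (auto simp: axis_def)
  have "norm (axis i (1::complex)) = 1"
    unfolding norm_vec_def L2_set_def e by simp
  then show ?thesis by blast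
qed

definition ray_of :: "complex^'n \<Rightarrow> 'n ray" where
  "ray_of \<psi> = Abs_ray (proj \<psi>)"

definition tensor :: "complex^'a \<Rightarrow> complex^'b \<Rightarrow> complex^('a \<times> 'b)" where
  "tensor \<psi> \<phi> = (\<chi> p. \<psi>$(fst p) * \<phi>$(snd p))"

definition cadjoint :: "complex^'n^'m \<Rightarrow> complex^'m^'n" where
  "cadjoint A = (\<chi> i j. cnj (A$j$i))"

definition hermitian :: "complex^'n^'n \<Rightarrow> bool" where
  "hermitian A \<longleftrightarrow> cadjoint A = A"

definition SU :: "(complex^'n^'n) set" where
  "SU = {U. cadjoint U ** U = mat 1 \<and> det U = 1}"

definition fscale :: "real \<Rightarrow> ('a \<Rightarrow> real) \<Rightarrow> ('a \<Rightarrow> real)" where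
  "fscale c f = (\<lambda>x. c * f x)"

abbreviation fspan :: "('a \<Rightarrow> real) set \<Rightarrow> ('a \<Rightarrow> real) set" where
  "fspan S \<equiv> module.span fscale S"

abbreviation findependent :: "('a \<Rightarrow> real) set \<Rightarrow> bool" where
  "findependent S \<equiv> \<not> module.dependent fscale S"

definition unit_opf :: "'n ray \<Rightarrow> real" where
  "unit_opf = (\<lambda>_. 1)"

definition is_opf :: "('n ray \<Rightarrow> real) \<Rightarrow> bool" where
  "is_opf F \<longleftrightarrow> (\<forall>r. 0 \<le> F r \<and> F r \<le> 1)"

definition opf_set :: "('n ray \<Rightarrow> real) set \<Rightarrow> bool" where
  "opf_set \<F> \<longleftrightarrow> (\<forall>F\<in>\<F>. is_opf F) \<and> unit_opf \<in> \<F>"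

definition C1 :: "(('n::finite) ray \<Rightarrow> real) set \<Rightarrow> bool" where
  "C1 \<F> \<longleftrightarrow> (\<forall>F\<in>\<F>. \<forall>U\<in>SU. \<exists>F'\<in>\<F>.
      \<forall>\<psi>::complex^'n. norm \<psi> = 1 \<longrightarrow> F' (ray_of \<psi>) = F (ray_of (U *v \<psi>)))"

definition C2 :: "('n ray \<Rightarrow> real) set \<Rightarrow> bool" where
  "C2 \<F> \<longleftrightarrow> (\<forall>r s. r \<noteq> s \<longrightarrow> (\<exists>F\<in>\<F>. F r \<noteq> F s))"

definition C3 :: "((('a::finite) ray \<Rightarrow> real) \<Rightarrow> (('b::finite) ray \<Rightarrow> real) \<Rightarrow> (('a \<times> 'b) ray \<Rightarrow> real))
      \<Rightarrow> ('a ray \<Rightarrow> real) set \<Rightarrow> ('b ray \<Rightarrow> real) set \<Rightarrow> bool" where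
  "C3 star \<F>A \<F>B \<longleftrightarrow> star unit_opf unit_opf = unit_opf \<and>
     (\<forall>FA\<in>\<F>A. \<forall>FB\<in>\<F>B. \<forall>\<psi>::complex^'a. \<forall>\<phi>::complex^'b.
        norm \<psi> = 1 \<longrightarrow> norm \<phi> = 1 \<longrightarrow>
        star FA FB (ray_of (tensor \<psi> \<phi>)) = FA (ray_of \<psi>) * FB (ray_of \<phi>))"

definition finiteness_principle :: "('n ray \<Rightarrow> real) set \<Rightarrow> bool" where
  "finiteness_principle \<F> \<longleftrightarrow> (\<exists>B. finite B \<and> fspan \<F> = fspan B)"

definition born_form :: "(('n::finite) ray \<Rightarrow> real) \<Rightarrow> bool" where
  "born_form F \<longleftrightarrow> (\<exists>H :: complex^'n^'n. hermitian H \<and>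
      (\<forall>r. complex_of_real (F r) = trace (H ** Rep_ray r)))"

definition alternative :: "(('n::finite) ray \<Rightarrow> real) set \<Rightarrow> bool" where
  "alternative \<F> \<longleftrightarrow> (\<exists>F\<in>\<F>. \<not> born_form F)"

definition bilinear_product :: "(('a ray \<Rightarrow> real) \<Rightarrow> ('b ray \<Rightarrow> real) \<Rightarrow> ('c ray \<Rightarrow> real))
      \<Rightarrow> ('a ray \<Rightarrow> real) set \<Rightarrow> ('b ray \<Rightarrow> real) set \<Rightarrow> ('c ray \<Rightarrow> real) set \<Rightarrow> bool" where
  "bilinear_product star \<F>A \<F>B \<F>C \<longleftrightarrow>
     (\<forall>FA\<in>\<F>A. \<forall>FB\<in>\<F>B. star FA FB \<in> \<F>C) \<and>
     (\<forall>f\<in>fspan \<F>A. \<forall>g\<in>fspan \<F>A. \<forall>h\<in>fspan \<F>B. \<forall>a b.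
        star (fscale a f + fscale b g) h = fscale a (star f h) + fscale b (star g h)) \<and>
     (\<forall>f\<in>fspan \<F>A. \<forall>g\<in>fspan \<F>B. \<forall>h\<in>fspan \<F>B. \<forall>a b.
        star f (fscale a g + fscale b h) = fscale a (star f g) + fscale b (star f h))"

end

(* Local tomography says that a function in the span of F9 is determined by its values on product
   states, so it suffices to find a nonzero function in that span V vanishing on all of them.

   V is a finite-dimensional SU(9)-invariant space of bounded functions on projective space. A
   fixed-point argument (no continuity or Haar measure is available) gives an invariant
   nondegenerate kernel k with V spanned by the functions k(x, .), and two-point transitivity makes
   k(x, y) a function of |<x, y>|^2. The pigeonhole principle in V together with isosceles triangles
   (van der Waerden's trick) shows that this function is continuous, and finite dimension leaves it
   finitely many Fourier coefficients on a circle, so k(x, y) = P(|<x, y>|^2) for a polynomial P.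
   If P were affine, V would consist of Born forms, so N = deg P is at least 2. Extracting Fourier
   and Taylor coefficients in x from P(|<x, v>|^2) then produces the function
   v_11^(N-2) (v_12 v_21 - v_11 v_22) cnj(v_33)^N in the complexification of V. *)

theory Submission
  imports Defs
begin

text \<open>Functions in an OPF set carry no regularity at all, so the decomposition of continuous
  functions under SU(9) cannot be applied directly. Finite dimension is used through finitely many
  interpolation nodes instead: they make V closed under pointwise limits and under the integrals
  that occur, and they make bounded sets totally bounded. The final function comes from
  representation theory. A form of degree N in the v_p with p other than 33, times cnj(v_33)^N, is
  harmonic, so it lies in the top SU(9)-component of the polynomials of bidegree (N, N), and this
  component occurs because the leading coefficient of P is nonzero. The factor v_12 v_21 - v_11 v_22
  is a minor of the 3 by 3 coefficient matrix of v, which has rank one for product vectors; being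
  quadratic, it needs N >= 2. The entry 33 lies outside that minor, and the function is nonzero at
  the maximally entangled vector. The formal argument replaces the representation theory by explicit
  unit vectors x and by polynomials in a parameter evaluated at finitely many points, so that only
  linear combinations are formed.\<close>

section \<open>Interpolation and fixed points in finite-dimensional function spaces\<close>

interpretation fs: vector_space "fscale :: real \<Rightarrow> ('a \<Rightarrow> real) \<Rightarrow> 'a \<Rightarrow> real"
  by standard (auto simp: fscale_def fun_eq_iff algebra_simps)

lemma sum_fun_apply: "(\<Sum>i\<in>A. f i) x = (\<Sum>i\<in>A. f i x :: 'b::comm_monoid_add)"
  by (induction A rule: infinite_finite_induct) auto

text \<open>Elimination on points: the interpolation error \<open>b'\<close> of a new generator is
  either zero, or any point where it is nonzero serves as one more node. Values at the nodes are
  then coordinates, with dual basis \<open>L\<close>.\<close>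

lemma interpolation_nodes:
  fixes B :: "('x \<Rightarrow> real) set"
  assumes "finite B"
  shows "\<exists>I L. finite I \<and> (\<forall>x\<in>I. L x \<in> fspan B)
    \<and> (\<forall>x\<in>I. \<forall>y\<in>I. L x y = (if x = y then 1 else 0))
    \<and> (\<forall>f\<in>fspan B. \<forall>y. f y = (\<Sum>x\<in>I. f x * L x y))"
  using assms
proof (induction B rule: finite_induct)
  case empty
  show ?case by (rule exI[of _ "{}"]) (simp add: zero_fun_def)
next
  case (insert b B)
  then obtain I L where I: "finite I" "\<forall>x\<in>I. L x \<in> fspan B"
     "\<forall>x\<in>I. \<forall>y\<in>I. L x y = (if x = y then 1 else 0)"
     "\<forall>f\<in>fspan B. \<forall>y. f y = (\<Sum>x\<in>I. f x * L x y)" by blast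
  define b' where "b' = b - (\<Sum>x\<in>I. fscale (b x) (L x))"
  have s: "(\<Sum>x\<in>I. fscale (b x) (L x)) \<in> fspan B"
    using I(2) by (intro fs.span_sum fs.span_scale) auto
  have b'_eval: "b' y = b y - (\<Sum>x\<in>I. b x * L x y)" for y
    by (simp add: b'_def sum_fun_apply fscale_def)
  have b'_I: "b' y = 0" if "y \<in> I" for y
  proof -
    have "(\<Sum>x\<in>I. b x * L x y) = (\<Sum>x\<in>I. if x = y then b x else 0)"
      using I(3) that by (intro sum.cong) auto
    then show ?thesis using that I(1) by (simp add: b'_eval)
  qed
  have split: "\<exists>g c. g \<in> fspan B \<and> f = g + fscale c b'" if f: "f \<in> fspan (insert b B)" for f
  proof -
    obtain c where c: "f - fscale c b \<in> fspan B" using f by (auto simp: fs.span_breakdown_eq)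
    have "f = ((f - fscale c b) + fscale c (\<Sum>x\<in>I. fscale (b x) (L x))) + fscale c b'"
      by (simp add: b'_def fs.scale_right_diff_distrib)
    moreover have "(f - fscale c b) + fscale c (\<Sum>x\<in>I. fscale (b x) (L x)) \<in> fspan B"
      by (intro fs.span_add fs.span_scale c s)
    ultimately show ?thesis by metis
  qed
  have mono: "fspan B \<subseteq> fspan (insert b B)" by (rule fs.span_mono) auto
  have b'_mem: "b' \<in> fspan (insert b B)"
    unfolding b'_def using s mono by (intro fs.span_diff) (auto intro: fs.span_base)
  show ?case
  proof (cases "b' = 0")
    case True
    then have "b = (\<Sum>x\<in>I. fscale (b x) (L x))" unfolding b'_def by (rule eq_iff_diff_eq_0[THEN iffD2])
    with s have "b \<in> fspan B" by metis
    then have "fspan (insert b B) = fspan B" by (rule fs.span_redundant)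
    then show ?thesis using insert.IH by (simp only:)
  next
    case False
    then obtain x0 where x0: "b' x0 \<noteq> 0" by (auto simp: fun_eq_iff)
    then have x0I: "x0 \<notin> I" using b'_I by blast
    define b1 where "b1 = fscale (1 / b' x0) b'"
    have b1: "b1 x0 = 1" "\<And>y. y \<in> I \<Longrightarrow> b1 y = 0" using x0 b'_I by (auto simp: b1_def fscale_def)
    have b1_mem: "b1 \<in> fspan (insert b B)" using b'_mem by (simp add: b1_def fs.span_scale)
    \<comment> \<open>\<open>b1\<close> vanishes at the old nodes, so subtracting multiples of it
      makes the old basis functions vanish at \<open>x0\<close> and keeps their values on
      \<open>I\<close>.\<close>
    define L' where "L' x = (if x = x0 then b1 else L x - fscale (L x x0) b1)" for x
    have 1: "\<forall>x\<in>insert x0 I. L' x \<in> fspan (insert b B)"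
      using I(2) mono b1_mem by (auto simp: L'_def intro!: fs.span_diff fs.span_scale)
    have 2: "\<forall>x\<in>insert x0 I. \<forall>y\<in>insert x0 I. L' x y = (if x = y then 1 else 0)"
      using I(3) b1 x0I by (auto simp: L'_def fscale_def)
    have 3: "f y = (\<Sum>x\<in>insert x0 I. f x * L' x y)" if f: "f \<in> fspan (insert b B)" for f y
    proof -
      obtain g c where g: "g \<in> fspan B" "f = g + fscale c b'" using split[OF f] by blast
      define d where "d = c * b' x0"
      have f_eval: "f z = g z + d * b1 z" for z
        using x0 by (simp add: g(2) fscale_def b1_def d_def)
      have "(\<Sum>x\<in>I. f x * L' x y) = (\<Sum>x\<in>I. g x * (L x y - L x x0 * b1 y))"
        using x0I b1 by (intro sum.cong) (auto simp: L'_def f_eval fscale_def)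
      also have "\<dots> = g y - g x0 * b1 y"
        unfolding I(4)[rule_format, OF g(1), of y] I(4)[rule_format, OF g(1), of x0]
        by (simp only: right_diff_distrib sum_subtractf sum_distrib_right mult.assoc)
      finally show ?thesis using x0I I(1) b1 by (simp add: f_eval L'_def algebra_simps)
    qed
    show ?thesis
      by (rule exI[of _ "insert x0 I"], rule exI[of _ L']) (intro conjI 1 2 ballI allI 3 finite.insertI I(1))
  qed
qed

(* By the parallelogram law a minimising sequence for \<phi>, the supremum over G of a squared seminorm,
   is Cauchy, and so is its image under any g in G. *)
lemma invariant_limit_point:
  fixes C :: "('y \<Rightarrow> real) set"
  assumes J: "finite J" and ne: "C \<noteq> {}"
    and bounded: "\<And>h y. h \<in> C \<Longrightarrow> \<bar>h y\<bar> \<le> M"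
    and mid: "\<And>h h'. h \<in> C \<Longrightarrow> h' \<in> C \<Longrightarrow> (\<lambda>y. (h y + h' y) / 2) \<in> C"
    and inv: "\<And>h g. h \<in> C \<Longrightarrow> g \<in> G \<Longrightarrow> (\<lambda>y. h (g y)) \<in> C"
    and Gne: "G \<noteq> {}"
    and comp: "\<And>g g'. g \<in> G \<Longrightarrow> g' \<in> G \<Longrightarrow> (\<lambda>y. g (g' y)) \<in> G"
    and surj: "\<And>g. g \<in> G \<Longrightarrow> surj g"
    and control: "\<And>h h' y. h \<in> C \<Longrightarrow> h' \<in> C \<Longrightarrow> \<bar>h y - h' y\<bar> \<le> c * (\<Sum>j\<in>J. \<bar>h j - h' j\<bar>)"
    and c: "c \<ge> 0"
  shows "\<exists>k \<kappa>. (\<forall>n::nat. \<kappa> n \<in> C) \<and> (\<forall>y. (\<lambda>n. \<kappa> n y) \<longlonglongrightarrow> k y) \<and> (\<forall>g\<in>G. \<forall>y. k (g y) = k y)"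
proof -
  define N where "N h = (\<Sum>j\<in>J. (h j)\<^sup>2)" for h :: "'y \<Rightarrow> real"
  define \<phi> where "\<phi> h = (SUP g\<in>G. N (\<lambda>y. h (g y)))" for h
  have N_nonneg: "0 \<le> N h" for h by (auto simp: N_def intro: sum_nonneg)
  have N_bound: "N h \<le> card J * M\<^sup>2" if "h \<in> C" for h
    unfolding N_def
    by (rule sum_bounded_above) (use bounded[OF that] in \<open>metis abs_ge_zero power2_abs power_mono\<close>)
  have bdd: "bdd_above ((\<lambda>g. N (\<lambda>y. h (g y))) ` G)" if "h \<in> C" for h
    by (rule bdd_aboveI2[of _ _ "card J * M\<^sup>2"]) (use N_bound inv that in auto)
  have N_le: "N (\<lambda>y. h (g y)) \<le> \<phi> h" if "h \<in> C" "g \<in> G" for h g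
    unfolding \<phi>_def by (rule cSUP_upper[OF that(2) bdd[OF that(1)]])
  have \<phi>_nonneg: "0 \<le> \<phi> h" if "h \<in> C" for h
    using Gne N_le[OF that] N_nonneg by (meson all_not_in_conv order_trans)
  have \<phi>_inv: "\<phi> (\<lambda>y. h (g y)) \<le> \<phi> h" if "h \<in> C" "g \<in> G" for h g
    unfolding \<phi>_def[of "\<lambda>y. h (g y)"]
    by (rule cSUP_least[OF Gne]) (use N_le[OF that(1) comp[OF that(2)]] in auto)
  define m where "m = (INF h\<in>C. \<phi> h)"
  have bdd': "bdd_below (\<phi> ` C)" by (rule bdd_belowI2[of _ 0]) (use \<phi>_nonneg in auto)
  have m_le: "m \<le> \<phi> h" if "h \<in> C" for h unfolding m_def by (rule cINF_lower[OF bdd' that])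
  have close: "\<bar>h y - h' y\<bar> \<le> c * card J * sqrt (8 * e)"
    if h: "h \<in> C" "h' \<in> C" "\<phi> h < m + e" "\<phi> h' < m + e" and e: "e > 0" for h h' e y
  proof -
    let ?mid = "\<lambda>y. (h y + h' y) / 2"
    \<comment> \<open>The midpoint cannot get below \<open>m\<close>, so for some \<open>g\<close>
      its translate has \<open>N\<close> above \<open>m - e\<close>; the parallelogram law for that
      \<open>g\<close> leaves less than \<open>8 * e\<close> for the difference.\<close>
    have "m - e < \<phi> ?mid" using m_le[OF mid[OF h(1,2)]] e by linarith
    then obtain g where g: "g \<in> G" "m - e < N (\<lambda>y. ?mid (g y))"
      unfolding \<phi>_def using less_cSUP_iff[OF Gne bdd[OF mid[OF h(1,2)]]] by blast
    have "N (\<lambda>y. ?mid (g y)) = N (\<lambda>y. h (g y)) / 2 + N (\<lambda>y. h' (g y)) / 2 - N (\<lambda>y. h (g y) - h' (g y)) / 4"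
      unfolding N_def sum_divide_distrib sum.distrib[symmetric] sum_subtractf[symmetric]
      by (intro sum.cong refl) (simp add: field_simps power2_eq_square)
    with g(2) N_le[OF h(1) g(1)] N_le[OF h(2) g(1)] h(3,4)
    have n8: "N (\<lambda>y. h (g y) - h' (g y)) < 8 * e" by argo
    have each: "\<bar>h (g j) - h' (g j)\<bar> \<le> sqrt (8 * e)" if "j \<in> J" for j
    proof -
      have "(h (g j) - h' (g j))\<^sup>2 \<le> N (\<lambda>y. h (g y) - h' (g y))"
        unfolding N_def by (rule member_le_sum[OF that _ J]) auto
      then show ?thesis using n8 by (intro real_le_rsqrt) (simp)
    qed
    \<comment> \<open>The difference is known to be small at the translated nodes
      \<open>g j\<close>; \<open>control\<close> for the translated functions extends this to all
      points \<open>g y'\<close>, which are all points.\<close>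
    obtain y' where y': "y = g y'" using surj[OF g(1)] by auto
    have "\<bar>h y - h' y\<bar> \<le> c * (\<Sum>j\<in>J. \<bar>h (g j) - h' (g j)\<bar>)"
      unfolding y' by (rule control[OF inv[OF h(1) g(1)] inv[OF h(2) g(1)]])
    also have "\<dots> \<le> c * (card J * sqrt (8 * e))"
      by (intro mult_left_mono sum_bounded_above c each)
    finally show ?thesis by (simp add: mult.assoc)
  qed
  have "\<exists>h\<in>C. \<phi> h < m + 1 / real (Suc n)" for n
    using cINF_less_iff[OF ne bdd', of "m + 1 / real (Suc n)"] by (simp add: m_def)
  then obtain \<kappa> where \<kappa>: "\<And>n. \<kappa> n \<in> C" "\<And>n. \<phi> (\<kappa> n) < m + 1 / real (Suc n)" by metis
  define b where "b n = c * card J * sqrt (8 * (1 / real (Suc n)))" for n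
  have "(\<lambda>n. c * card J * sqrt (8 * (1 / real (Suc n)))) \<longlonglongrightarrow> c * card J * sqrt (8 * 0)"
    by (intro tendsto_intros LIMSEQ_Suc[OF lim_1_over_n])
  then have b0: "b \<longlonglongrightarrow> 0" by (simp add: b_def[abs_def])
  have b_close: "\<bar>\<kappa> i y - \<kappa> j y\<bar> \<le> b n" if "i \<ge> n" "j \<ge> n" for i j n y
  proof -
    have "1 / real (Suc i) \<le> 1 / real (Suc n)" "1 / real (Suc j) \<le> 1 / real (Suc n)"
      using that by (auto simp: field_simps)
    then show ?thesis unfolding b_def
      using \<kappa>(2)[of i] \<kappa>(2)[of j] by (intro close \<kappa>(1)) auto
  qed
  have "Cauchy (\<lambda>n. \<kappa> n y)" for y
  proof (rule metric_CauchyI)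
    fix e :: real assume "e > 0"
    then obtain n where n: "b n < e"
      using order_tendstoD(2)[OF b0] unfolding eventually_sequentially by blast
    show "\<exists>n. \<forall>i\<ge>n. \<forall>j\<ge>n. dist (\<kappa> i y) (\<kappa> j y) < e"
      unfolding dist_real_def using b_close n by (meson le_less_trans)
  qed
  then have "\<exists>l. (\<lambda>n. \<kappa> n y) \<longlonglongrightarrow> l" for y using Cauchy_convergent convergent_def by blast
  then obtain k where k: "\<And>y. (\<lambda>n. \<kappa> n y) \<longlonglongrightarrow> k y" by metis
  have "k (g y) = k y" if g: "g \<in> G" for g y
  proof -
    \<comment> \<open>Translation does not increase \<open>\<phi>\<close>, so the translate of
      \<open>\<kappa> n\<close> is as nearly minimal as \<open>\<kappa> n\<close> and
      \<open>close\<close> compares the two.\<close>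
    have "\<bar>\<kappa> n (g y) - \<kappa> n y\<bar> \<le> b n" for n
      unfolding b_def
      by (rule close[OF inv[OF \<kappa>(1) g] \<kappa>(1) le_less_trans[OF \<phi>_inv[OF \<kappa>(1) g] \<kappa>(2)] \<kappa>(2)])
        simp
    then have "(\<lambda>n. \<kappa> n (g y) - \<kappa> n y) \<longlonglongrightarrow> 0"
      by (intro Lim_null_comparison[OF _ b0]) auto
    moreover have "(\<lambda>n. \<kappa> n (g y) - \<kappa> n y) \<longlonglongrightarrow> k (g y) - k y" by (intro tendsto_diff k)
    ultimately show ?thesis using LIMSEQ_unique by fastforce
  qed
  then show ?thesis using \<kappa>(1) k by blast
qed

section \<open>Invariant kernels\<close>

text \<open>Finite dimension enters only through the Lagrange basis \<open>L\<close> at the nodes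
  \<open>I\<close>; a uniform bound on \<open>L\<close> then bounds every function by its values at
  the nodes.\<close>

locale invariant_function_space =
  fixes V :: "('x \<Rightarrow> real) set" and G :: "('x \<Rightarrow> 'x) set"
    and I :: "'x set" and L :: "'x \<Rightarrow> 'x \<Rightarrow> real" and M :: real
  assumes subspace: "fs.subspace V"
    and finite_I: "finite I"
    and L_mem: "\<And>x. x \<in> I \<Longrightarrow> L x \<in> V"
    and L_delta: "\<And>x y. x \<in> I \<Longrightarrow> y \<in> I \<Longrightarrow> L x y = (if x = y then 1 else 0)"
    and interpolate: "\<And>f y. f \<in> V \<Longrightarrow> f y = (\<Sum>x\<in>I. f x * L x y)"
    and L_bound: "\<And>x y. x \<in> I \<Longrightarrow> \<bar>L x y\<bar> \<le> M"
    and M_nonneg: "0 \<le> M"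
    and G_nonempty: "G \<noteq> {}"
    and G_comp: "\<And>g h. g \<in> G \<Longrightarrow> h \<in> G \<Longrightarrow> (\<lambda>x. g (h x)) \<in> G"
    and G_inverse: "\<And>g. g \<in> G \<Longrightarrow> \<exists>h\<in>G. (\<forall>x. g (h x) = x) \<and> (\<forall>x. h (g x) = x)"
    and G_invariant: "\<And>f g. f \<in> V \<Longrightarrow> g \<in> G \<Longrightarrow> (\<lambda>x. f (g x)) \<in> V"
begin

section \<open>Functions determined by their values at the nodes\<close>

lemma combination_mem: "(\<lambda>y. \<Sum>x\<in>I. c x * L x y) \<in> V"
proof -
  have "(\<lambda>y. \<Sum>x\<in>I. c x * L x y) = (\<Sum>x\<in>I. fscale (c x) (L x))"
    by (auto simp: sum_fun_apply fscale_def)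
  then show ?thesis
    by (simp add: fs.subspace_sum[OF subspace] fs.subspace_scale[OF subspace] L_mem)
qed

text \<open>Membership becomes an identity linear in \<open>f\<close>. Such identities survive
  pointwise limits and integration, as in \<open>limit_mem\<close> and
  \<open>harmonic_mem\<close>.\<close>

lemma mem_if_interpolated:
  assumes "\<And>y. f y = (\<Sum>x\<in>I. f x * L x y)"
  shows "f \<in> V"
proof -
  have "f = (\<lambda>y. \<Sum>x\<in>I. f x * L x y)" using assms by (rule ext)
  then show ?thesis using combination_mem by metis
qed

lemma limit_mem:
  assumes "\<And>n::nat. h n \<in> V" "\<And>y. (\<lambda>n. h n y) \<longlonglongrightarrow> f y"
  shows "f \<in> V"
proof (rule mem_if_interpolated)
  fix y
  have "(\<lambda>n. \<Sum>x\<in>I. h n x * L x y) \<longlonglongrightarrow> (\<Sum>x\<in>I. f x * L x y)"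
    by (intro tendsto_sum tendsto_mult_right assms)
  moreover have "(\<lambda>n. \<Sum>x\<in>I. h n x * L x y) = (\<lambda>n. h n y)"
    using interpolate[OF assms(1)] by metis
  ultimately show "f y = (\<Sum>x\<in>I. f x * L x y)"
    using assms(2)[of y] LIMSEQ_unique by metis
qed

lemma add_mem: "f \<in> V \<Longrightarrow> g \<in> V \<Longrightarrow> (\<lambda>y. f y + g y) \<in> V"
  using fs.subspace_add[OF subspace] by (simp add: plus_fun_def)

lemma scale_mem: "f \<in> V \<Longrightarrow> (\<lambda>y. c * f y) \<in> V"
  using fs.subspace_scale[OF subspace, of f c] by (simp add: fscale_def)

lemma diff_mem: "f \<in> V \<Longrightarrow> g \<in> V \<Longrightarrow> (\<lambda>y. f y - g y) \<in> V"
  using fs.subspace_diff[OF subspace] by (simp add: fun_diff_def)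

lemma G_surj: "g \<in> G \<Longrightarrow> surj g"
  using G_inverse by (metis surjI)

lemma abs_le_nodes:
  assumes "f \<in> V"
  shows "\<bar>f y\<bar> \<le> M * (\<Sum>x\<in>I. \<bar>f x\<bar>)"
proof -
  have "\<bar>f y\<bar> = \<bar>\<Sum>x\<in>I. f x * L x y\<bar>" using interpolate[OF assms, of y] by (rule arg_cong)
  also have "\<dots> \<le> (\<Sum>x\<in>I. \<bar>f x * L x y\<bar>)" by (rule sum_abs)
  also have "\<dots> \<le> (\<Sum>x\<in>I. \<bar>f x\<bar> * M)"
    unfolding abs_mult by (intro sum_mono mult_left_mono L_bound) auto
  finally show ?thesis by (simp add: sum_distrib_left mult.commute)
qed

lemma V_subset_span_nodes: "V \<subseteq> fspan (L ` I)"
proof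
  fix f assume f: "f \<in> V"
  have "f = (\<Sum>x\<in>I. fscale (f x) (L x))"
    by (rule ext, subst interpolate[OF f]) (simp add: sum_fun_apply fscale_def)
  moreover have "(\<Sum>x\<in>I. fscale (f x) (L x)) \<in> fspan (L ` I)"
    by (intro fs.span_sum fs.span_scale fs.span_base) auto
  ultimately show "f \<in> fspan (L ` I)" by metis
qed

text \<open>\<open>vanish\<close> is independence of an indexed family, so a repeated member
  contradicts it through the weights 1 and -1. The bound by \<open>card I\<close> is the dimension
  count that limits the number of Fourier modes.\<close>

lemma independent_family:
  fixes z :: "'i \<Rightarrow> 'x \<Rightarrow> real"
  assumes T: "finite T" and zV: "\<And>i. i \<in> T \<Longrightarrow> z i \<in> V"
    and vanish: "\<And>a i. (\<And>y. (\<Sum>x\<in>T. a x * z x y) = 0) \<Longrightarrow> i \<in> T \<Longrightarrow> a i = 0"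
  shows "inj_on z T" "findependent (z ` T)" "card T \<le> card I"
proof -
  show inj: "inj_on z T"
  proof (rule inj_onI)
    fix i j assume ij: "i \<in> T" "j \<in> T" "z i = z j"
    show "i = j"
    proof (rule ccontr)
      assume "i \<noteq> j"
      define a where "a x = (if x = i then 1 else if x = j then -1 else 0 :: real)" for x
      have "(\<Sum>x\<in>T. a x * z x y) = (\<Sum>x\<in>T. (if x = i then z i y else 0) - (if x = j then z i y else 0))" for y
        using ij(3) \<open>i \<noteq> j\<close> by (intro sum.cong) (auto simp: a_def)
      then have "(\<Sum>x\<in>T. a x * z x y) = 0" for y
        using ij T by (simp add: sum_subtractf)
      from vanish[OF this ij(1)] show False by (simp add: a_def)
    qed
  qed
  show indep: "findependent (z ` T)"
  proof (rule fs.independent_if_scalars_zero)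
    show "finite (z ` T)" using T by simp
    fix f v assume f: "(\<Sum>x\<in>z ` T. fscale (f x) x) = 0" and v: "v \<in> z ` T"
    have "(\<Sum>x\<in>T. f (z x) * z x y) = 0" for y
      using fun_cong[OF f, of y] by (simp add: sum.reindex[OF inj] sum_fun_apply fscale_def)
    from vanish[of "\<lambda>x. f (z x)", OF this] show "f v = 0" using v by blast
  qed
  have "z ` T \<subseteq> fspan (L ` I)" using zV V_subset_span_nodes by blast
  then have "card (z ` T) \<le> card (L ` I)"
    using fs.independent_span_bound[OF _ indep] finite_I by blast
  also have "\<dots> \<le> card I" by (rule card_image_le[OF finite_I])
  finally show "card T \<le> card I" by (simp add: card_image[OF inj])
qed

section \<open>Nondegenerate symmetric kernels\<close>

definition unit_ball :: "('x \<Rightarrow> real) set" where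
  "unit_ball = {f \<in> V. \<forall>y. \<bar>f y\<bar> \<le> 1}"

text \<open>The last clause expresses nondegeneracy in a form that is invariant under \<^term>\<open>G\<close> and
  stable under midpoints and pointwise limits.\<close>

definition kernels :: "('x \<times> 'x \<Rightarrow> real) set" where
  "kernels = {h. (\<forall>x. (\<lambda>y. h (x, y)) \<in> V) \<and> (\<forall>x y. h (x, y) = h (y, x))
     \<and> (\<forall>p. \<bar>h p\<bar> \<le> (card I)\<^sup>2 * M\<^sup>2)
     \<and> (\<forall>f\<in>unit_ball. \<forall>S a. finite S \<longrightarrow>
         (\<Sum>x\<in>S. a x * f x)\<^sup>2 \<le> (\<Sum>x\<in>S. \<Sum>y\<in>S. a x * a y * h (x, y)))}"

lemma kernels_mem: "h \<in> kernels \<Longrightarrow> (\<lambda>y. h (x, y)) \<in> V"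
  and kernels_sym: "h \<in> kernels \<Longrightarrow> h (x, y) = h (y, x)"
  and kernels_bound: "h \<in> kernels \<Longrightarrow> \<bar>h p\<bar> \<le> (card I)\<^sup>2 * M\<^sup>2"
  and kernels_psd: "h \<in> kernels \<Longrightarrow> f \<in> unit_ball \<Longrightarrow> finite S \<Longrightarrow>
    (\<Sum>x\<in>S. a x * f x)\<^sup>2 \<le> (\<Sum>x\<in>S. \<Sum>y\<in>S. a x * a y * h (x, y))"
  unfolding kernels_def by blast+

text \<open>A multiple of the Gram kernel of the dual basis works. A functional on \<open>V\<close>
  is a combination of node values, Cauchy-Schwarz separates the values \<open>f i\<close> from the
  rest, and the sum of their squares is at most \<open>card I\<close> on the unit ball. This is the
  origin of the factor in \<open>k0\<close> and of the bound in \<open>kernels\<close>.\<close>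

lemma kernels_nonempty: "kernels \<noteq> {}"
proof -
  define k0 where "k0 = (\<lambda>(x, y). card I * (\<Sum>i\<in>I. L i x * L i y))"
  have "k0 \<in> kernels"
    unfolding kernels_def
  proof (intro CollectI conjI allI ballI impI)
    fix x
    have "(\<lambda>y. k0 (x, y)) = (\<lambda>y. \<Sum>i\<in>I. (card I * L i x) * L i y)"
      by (simp add: k0_def sum_distrib_left mult.assoc)
    then show "(\<lambda>y. k0 (x, y)) \<in> V" using combination_mem by metis
  next
    fix x y
    show "k0 (x, y) = k0 (y, x)" by (simp add: k0_def mult.commute)
  next
    fix p :: "'x \<times> 'x"
    obtain x y where p: "p = (x, y)" by fastforce
    have "\<bar>\<Sum>i\<in>I. L i x * L i y\<bar> \<le> (\<Sum>i\<in>I. \<bar>L i x * L i y\<bar>)" by (rule sum_abs)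
    also have "\<dots> \<le> (\<Sum>i\<in>I. M * M)"
      unfolding abs_mult by (intro sum_mono mult_mono L_bound M_nonneg) auto
    finally have "\<bar>\<Sum>i\<in>I. L i x * L i y\<bar> \<le> card I * M\<^sup>2" by (simp add: power2_eq_square)
    then have "card I * \<bar>\<Sum>i\<in>I. L i x * L i y\<bar> \<le> card I * (card I * M\<^sup>2)"
      by (intro mult_left_mono) auto
    then show "\<bar>k0 p\<bar> \<le> (card I)\<^sup>2 * M\<^sup>2" by (simp add: k0_def p abs_mult power2_eq_square mult.assoc)
  next
    fix f :: "'x \<Rightarrow> real" and S :: "'x set" and a :: "'x \<Rightarrow> real"
    assume f: "f \<in> unit_ball" and S: "finite S"
    have fV: "f \<in> V" and f1: "\<And>y. \<bar>f y\<bar> \<le> 1" using f by (auto simp: unit_ball_def)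
    define l where "l i = (\<Sum>x\<in>S. a x * L i x)" for i
    have "(\<Sum>x\<in>S. a x * f x) = (\<Sum>x\<in>S. \<Sum>i\<in>I. f i * (a x * L i x))"
    proof (rule sum.cong[OF refl])
      fix x
      show "a x * f x = (\<Sum>i\<in>I. f i * (a x * L i x))"
        by (subst interpolate[OF fV]) (simp add: sum_distrib_left mult_ac)
    qed
    also have "\<dots> = (\<Sum>i\<in>I. f i * l i)"
      by (subst sum.swap) (simp add: l_def sum_distrib_left)
    finally have "(\<Sum>x\<in>S. a x * f x)\<^sup>2 = (\<Sum>i\<in>I. f i * l i)\<^sup>2" by (rule arg_cong)
    also have "\<dots> \<le> (\<Sum>i\<in>I. (f i)\<^sup>2) * (\<Sum>i\<in>I. (l i)\<^sup>2)" by (rule Cauchy_Schwarz_ineq_sum)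
    also have "\<dots> \<le> card I * (\<Sum>i\<in>I. (l i)\<^sup>2)"
    proof (rule mult_right_mono)
      have "(f i)\<^sup>2 \<le> 1" for i using f1[of i] by (simp add: abs_square_le_1)
      then show "(\<Sum>i\<in>I. (f i)\<^sup>2) \<le> card I" using sum_bounded_above[of I "\<lambda>i. (f i)\<^sup>2" 1] by simp
    qed (auto intro: sum_nonneg)
    also have "(\<Sum>i\<in>I. (l i)\<^sup>2) = (\<Sum>i\<in>I. \<Sum>x\<in>S. \<Sum>y\<in>S. a x * a y * (L i x * L i y))"
      unfolding l_def power2_eq_square sum_product by (simp add: mult_ac)
    also have "\<dots> = (\<Sum>x\<in>S. \<Sum>i\<in>I. \<Sum>y\<in>S. a x * a y * (L i x * L i y))" by (rule sum.swap)
    also have "\<dots> = (\<Sum>x\<in>S. \<Sum>y\<in>S. \<Sum>i\<in>I. a x * a y * (L i x * L i y))"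
      by (rule sum.cong[OF refl], rule sum.swap)
    also have "card I * \<dots> = (\<Sum>x\<in>S. \<Sum>y\<in>S. a x * a y * k0 (x, y))"
      by (simp add: k0_def sum_distrib_left mult_ac)
    finally show "(\<Sum>x\<in>S. a x * f x)\<^sup>2 \<le> (\<Sum>x\<in>S. \<Sum>y\<in>S. a x * a y * k0 (x, y))" .
  qed
  then show ?thesis by blast
qed

lemma kernels_midpoint:
  assumes h: "h \<in> kernels" and h': "h' \<in> kernels"
  shows "(\<lambda>p. (h p + h' p) / 2) \<in> kernels"
  unfolding kernels_def
proof (intro CollectI conjI allI ballI impI)
  fix x
  have "(\<lambda>y. (1/2) * (h (x, y) + h' (x, y))) \<in> V"
    by (intro scale_mem add_mem kernels_mem h h')
  then show "(\<lambda>y. (h (x, y) + h' (x, y)) / 2) \<in> V" by simp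
next
  fix x y
  show "(h (x, y) + h' (x, y)) / 2 = (h (y, x) + h' (y, x)) / 2"
    using kernels_sym[OF h, of x y] kernels_sym[OF h', of x y] by simp
next
  fix p
  have "\<bar>h p\<bar> \<le> (card I)\<^sup>2 * M\<^sup>2" "\<bar>h' p\<bar> \<le> (card I)\<^sup>2 * M\<^sup>2" using kernels_bound h h' by blast+
  moreover have "\<bar>(a + b) / 2\<bar> \<le> c" if "\<bar>a\<bar> \<le> c" "\<bar>b\<bar> \<le> c" for a b c :: real
    using that abs_triangle_ineq[of a b] by simp
  ultimately show "\<bar>(h p + h' p) / 2\<bar> \<le> (card I)\<^sup>2 * M\<^sup>2" by blast
next
  fix f :: "'x \<Rightarrow> real" and S :: "'x set" and a :: "'x \<Rightarrow> real"
  assume f: "f \<in> unit_ball" and S: "finite S"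
  have 1: "(\<Sum>x\<in>S. a x * f x)\<^sup>2 \<le> (\<Sum>x\<in>S. \<Sum>y\<in>S. a x * a y * h (x, y))"
    "(\<Sum>x\<in>S. a x * f x)\<^sup>2 \<le> (\<Sum>x\<in>S. \<Sum>y\<in>S. a x * a y * h' (x, y))"
    by (rule kernels_psd[OF h f S], rule kernels_psd[OF h' f S])
  have eq: "(\<Sum>x\<in>S. \<Sum>y\<in>S. a x * a y * ((h (x, y) + h' (x, y)) / 2))
    = ((\<Sum>x\<in>S. \<Sum>y\<in>S. a x * a y * h (x, y)) + (\<Sum>x\<in>S. \<Sum>y\<in>S. a x * a y * h' (x, y))) / 2"
    by (simp add: sum.distrib[symmetric] sum_divide_distrib distrib_left)
  have avg: "u \<le> (v + w) / 2" if "u \<le> v" "u \<le> w" for u v w :: real using that by simp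
  show "(\<Sum>x\<in>S. a x * f x)\<^sup>2 \<le> (\<Sum>x\<in>S. \<Sum>y\<in>S. a x * a y * ((h (x, y) + h' (x, y)) / 2))"
    unfolding eq by (rule avg[OF 1])
qed

text \<open>The lower bound moves along with \<open>g\<close>: coefficients and test function are
  transported by the inverse \<open>g'\<close>, and the unit ball is stable under this.\<close>

lemma kernels_invariant:
  assumes h: "h \<in> kernels" and g: "g \<in> G"
  shows "(\<lambda>p. h (map_prod g g p)) \<in> kernels"
  unfolding kernels_def
proof (intro CollectI conjI allI ballI impI)
  fix x
  from G_invariant[OF kernels_mem[OF h, of "g x"] g] show "(\<lambda>y. h (map_prod g g (x, y))) \<in> V" by simp
next
  fix x y
  show "h (map_prod g g (x, y)) = h (map_prod g g (y, x))" using kernels_sym[OF h] by simp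
next
  fix p
  show "\<bar>h (map_prod g g p)\<bar> \<le> (card I)\<^sup>2 * M\<^sup>2" by (rule kernels_bound[OF h])
next
  fix f :: "'x \<Rightarrow> real" and S :: "'x set" and a :: "'x \<Rightarrow> real"
  assume f: "f \<in> unit_ball" and S: "finite S"
  obtain g' where g': "g' \<in> G" "\<And>x. g (g' x) = x" "\<And>x. g' (g x) = x" using G_inverse[OF g] by blast
  have inj: "inj_on g S" using g'(3) by (metis inj_onI)
  define a' where "a' z = a (g' z)" for z
  define f' where "f' z = f (g' z)" for z
  have f': "f' \<in> unit_ball"
    using f G_invariant[OF _ g'(1)] by (auto simp: unit_ball_def f'_def[abs_def])
  have "(\<Sum>z\<in>g ` S. a' z * f' z)\<^sup>2 \<le> (\<Sum>x\<in>g ` S. \<Sum>y\<in>g ` S. a' x * a' y * h (x, y))"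
    by (rule kernels_psd[OF h f']) (use S in simp)
  then show "(\<Sum>x\<in>S. a x * f x)\<^sup>2 \<le> (\<Sum>x\<in>S. \<Sum>y\<in>S. a x * a y * h (map_prod g g (x, y)))"
    by (simp add: sum.reindex[OF inj] a'_def f'_def g'(3))
qed

text \<open>Interpolation in one variable, then by symmetry in the other, reduces a kernel to its
  values on \<open>I \<times> I\<close>; each interpolation costs a factor \<open>M\<close>.\<close>

lemma kernels_control:
  assumes h: "h \<in> kernels" and h': "h' \<in> kernels"
  shows "\<bar>h p - h' p\<bar> \<le> M\<^sup>2 * (\<Sum>j\<in>I \<times> I. \<bar>h j - h' j\<bar>)"
proof -
  obtain x y where p: "p = (x, y)" by fastforce
  define d where "d u v = h (u, v) - h' (u, v)" for u v
  have d_mem: "d u \<in> V" for u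
    unfolding d_def[abs_def] by (intro diff_mem kernels_mem h h')
  have d_sym: "d u v = d v u" for u v
    using kernels_sym[OF h, of u v] kernels_sym[OF h', of u v] by (simp add: d_def)
  have "\<bar>d x y\<bar> \<le> M * (\<Sum>j\<in>I. \<bar>d x j\<bar>)" by (rule abs_le_nodes[OF d_mem])
  also have "\<dots> \<le> M * (\<Sum>j\<in>I. M * (\<Sum>i\<in>I. \<bar>d j i\<bar>))"
    by (intro mult_left_mono M_nonneg sum_mono) (subst d_sym, rule abs_le_nodes[OF d_mem])
  also have "\<dots> = M\<^sup>2 * (\<Sum>j\<in>I \<times> I. \<bar>h j - h' j\<bar>)"
    by (simp add: sum_distrib_left sum.cartesian_product d_def power2_eq_square mult.assoc
        case_prod_unfold)
  finally show ?thesis by (simp add: p d_def)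
qed

lemma kernels_limit:
  assumes \<kappa>: "\<And>n::nat. \<kappa> n \<in> kernels" and lim: "\<And>p. (\<lambda>n. \<kappa> n p) \<longlonglongrightarrow> h p"
  shows "h \<in> kernels"
  unfolding kernels_def
proof (intro CollectI conjI allI ballI impI)
  fix x
  show "(\<lambda>y. h (x, y)) \<in> V"
    by (rule limit_mem[of "\<lambda>n y. \<kappa> n (x, y)"], rule kernels_mem[OF \<kappa>], rule lim)
next
  fix x y
  have "(\<lambda>n. \<kappa> n (x, y)) \<longlonglongrightarrow> h (y, x)" unfolding kernels_sym[OF \<kappa>, of _ x y] by (rule lim)
  then show "h (x, y) = h (y, x)" using lim LIMSEQ_unique by blast
next
  fix p
  show "\<bar>h p\<bar> \<le> (card I)\<^sup>2 * M\<^sup>2"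
    by (rule LIMSEQ_le_const2[OF tendsto_rabs[OF lim]]) (use kernels_bound[OF \<kappa>] in blast)
next
  fix f :: "'x \<Rightarrow> real" and S :: "'x set" and a :: "'x \<Rightarrow> real"
  assume f: "f \<in> unit_ball" and S: "finite S"
  have le: "(\<Sum>x\<in>S. a x * f x)\<^sup>2 \<le> (\<Sum>x\<in>S. \<Sum>y\<in>S. a x * a y * \<kappa> n (x, y))" for n
    by (rule kernels_psd[OF \<kappa> f S])
  have "(\<lambda>n. \<Sum>x\<in>S. \<Sum>y\<in>S. a x * a y * \<kappa> n (x, y))
      \<longlonglongrightarrow> (\<Sum>x\<in>S. \<Sum>y\<in>S. a x * a y * h (x, y))"
    by (intro tendsto_intros lim)
  then show "(\<Sum>x\<in>S. a x * f x)\<^sup>2 \<le> (\<Sum>x\<in>S. \<Sum>y\<in>S. a x * a y * h (x, y))"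
    by (rule LIMSEQ_le_const) (use le in auto)
qed

text \<open>The sections of \<open>k\<close> at the nodes are independent: a relation between them
  makes the quadratic form of its coefficients zero, and nondegeneracy tested on a multiple of
  \<open>L i\<close> kills the coefficient at \<open>i\<close>. There are \<open>card I\<close> of
  them, so they span \<open>V\<close>.\<close>

lemma span_kernel:
  assumes k: "k \<in> kernels"
  shows "V = fspan (range (\<lambda>x y. k (x, y)))"
proof
  define z where "z x = (\<lambda>y. k (x, y))" for x
  have zV: "z x \<in> V" for x unfolding z_def by (rule kernels_mem[OF k])
  have vanish: "a i = 0" if a: "\<And>y. (\<Sum>x\<in>I. a x * z x y) = 0" and i: "i \<in> I" for a i
  proof -
    have "(\<Sum>x\<in>I. \<Sum>y\<in>I. a x * a y * k (x, y)) = (\<Sum>y\<in>I. a y * (\<Sum>x\<in>I. a x * z x y))"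
      by (subst sum.swap) (simp add: sum_distrib_left z_def mult_ac)
    also have "\<dots> = 0" by (simp add: a)
    finally have 0: "(\<Sum>x\<in>I. \<Sum>y\<in>I. a x * a y * k (x, y)) = 0" .
    \<comment> \<open>The factor brings \<open>L i\<close> into the unit ball; the
      \<open>+ 1\<close> avoids division by zero.\<close>
    define f where "f y = (1 / (M + 1)) * L i y" for y
    have "f \<in> V" unfolding f_def[abs_def] by (rule scale_mem[OF L_mem[OF i]])
    moreover have "\<bar>f y\<bar> \<le> 1" for y
      using L_bound[OF i, of y] M_nonneg by (simp add: f_def field_simps abs_mult)
    ultimately have "f \<in> unit_ball" by (simp add: unit_ball_def)
    then have "(\<Sum>x\<in>I. a x * f x)\<^sup>2 \<le> 0" using kernels_psd[OF k _ finite_I, of f a] 0 by simp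
    moreover have "(\<Sum>x\<in>I. a x * f x) = (\<Sum>x\<in>I. if i = x then a x / (M + 1) else 0)"
      by (intro sum.cong) (auto simp: f_def L_delta i)
    ultimately have "a i / (M + 1) = 0" using i finite_I by simp
    then show ?thesis using M_nonneg by auto
  qed
  have inj: "inj_on z I" and indep: "findependent (z ` I)"
    using independent_family[of I z] finite_I zV vanish by blast+
  have "V \<subseteq> fspan (z ` I)"
  proof (rule ccontr)
    assume "\<not> ?thesis"
    then obtain f where f: "f \<in> V" "f \<notin> fspan (z ` I)" by blast
    have "findependent (insert f (z ` I))" by (rule fs.independent_insertI[OF f(2) indep])
    moreover have "insert f (z ` I) \<subseteq> fspan (L ` I)" using f(1) zV V_subset_span_nodes by auto
    ultimately have "card (insert f (z ` I)) \<le> card (L ` I)"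
      using fs.independent_span_bound finite_I by blast
    moreover have "f \<notin> z ` I" using f(2) fs.span_base by blast
    ultimately have "Suc (card I) \<le> card (L ` I)" using finite_I by (simp add: card_image[OF inj])
    with card_image_le[OF finite_I, of L] show False by linarith
  qed
  also have "\<dots> \<subseteq> fspan (range z)" by (intro fs.span_mono) auto
  finally show "V \<subseteq> fspan (range (\<lambda>x y. k (x, y)))" by (simp add: z_def[abs_def])
  show "fspan (range (\<lambda>x y. k (x, y))) \<subseteq> V"
    by (rule fs.span_minimal[OF _ subspace]) (use zV in \<open>auto simp: z_def[abs_def]\<close>)
qed

text \<open>Kernels are functions on pairs, so the fixed-point lemma is applied to the diagonal
  action \<open>map_prod g g\<close> with nodes \<open>I \<times> I\<close>. The limit is again in
  \<open>kernels\<close>, hence still nondegenerate.\<close>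

theorem invariant_kernel:
  "\<exists>k B. (\<forall>x. k x \<in> V) \<and> (\<forall>x y. k x y = k y x) \<and> (\<forall>x y. \<bar>k x y\<bar> \<le> B)
     \<and> (\<forall>g\<in>G. \<forall>x y. k (g x) (g y) = k x y) \<and> V = fspan (range k)"
proof -
  have "\<exists>k \<kappa>. (\<forall>n::nat. \<kappa> n \<in> kernels) \<and> (\<forall>y. (\<lambda>n. \<kappa> n y) \<longlonglongrightarrow> k y)
      \<and> (\<forall>g\<in>(\<lambda>g. map_prod g g) ` G. \<forall>y. k (g y) = k y)"
  proof (rule invariant_limit_point[where J = "I \<times> I" and M = "(card I)\<^sup>2 * M\<^sup>2" and c = "M\<^sup>2"])
    show "\<And>g g'. g \<in> (\<lambda>g. map_prod g g) ` G \<Longrightarrow> g' \<in> (\<lambda>g. map_prod g g) ` G \<Longrightarrow>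
      (\<lambda>y. g (g' y)) \<in> (\<lambda>g. map_prod g g) ` G"
    proof (elim imageE)
      fix g g' f f' assume g: "g = map_prod f f" "g' = map_prod f' f'" "f \<in> G" "f' \<in> G"
      have "(\<lambda>y. g (g' y)) = map_prod (\<lambda>x. f (f' x)) (\<lambda>x. f (f' x))" by (auto simp: g fun_eq_iff)
      then show "(\<lambda>y. g (g' y)) \<in> (\<lambda>g. map_prod g g) ` G" using G_comp[OF g(3,4)] by blast
    qed
    show "surj g" if "g \<in> (\<lambda>g. map_prod g g) ` G" for g :: "'x \<times> 'x \<Rightarrow> 'x \<times> 'x"
    proof -
      from that obtain f where f: "g = map_prod f f" "f \<in> G" by blast
      show ?thesis using map_prod_surj[OF G_surj[OF f(2)] G_surj[OF f(2)]] by (simp add: f(1))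
    qed
  qed (use finite_I kernels_nonempty kernels_midpoint kernels_invariant kernels_control G_nonempty
      kernels_bound in auto)
  then obtain k \<kappa> where \<kappa>: "\<And>n::nat. \<kappa> n \<in> kernels" and lim: "\<And>y. (\<lambda>n. \<kappa> n y) \<longlonglongrightarrow> k y"
    and inv: "\<And>g p. g \<in> G \<Longrightarrow> k (map_prod g g p) = k p" by blast
  have k: "k \<in> kernels" by (rule kernels_limit[OF \<kappa> lim])
  show ?thesis
  proof (rule exI[of _ "\<lambda>x y. k (x, y)"], rule exI[of _ "(card I)\<^sup>2 * M\<^sup>2"], intro conjI)
    show "\<forall>g\<in>G. \<forall>x y. k (g x, g y) = k (x, y)" using inv by force
    show "V = fspan (range (\<lambda>x y. k (x, y)))" by (rule span_kernel[OF k])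
  qed (use kernels_mem[OF k] kernels_sym[OF k] kernels_bound[OF k] in blast)+
qed

text \<open>Total boundedness in the sup norm: the values at the nodes are rounded to cells of width
  \<open>d\<close>. Only finitely many roundings occur, and functions with the same rounding differ
  by at most \<open>M * (card I * d)\<close>.\<close>

lemma pigeonhole:
  fixes F :: "nat \<Rightarrow> 'x \<Rightarrow> real"
  assumes F: "\<And>n. F n \<in> V" and bounded: "\<And>n y. \<bar>F n y\<bar> \<le> B" and e: "0 < e"
  shows "\<exists>m n. m < n \<and> (\<forall>y. \<bar>F m y - F n y\<bar> \<le> e)"
proof -
  define d where "d = e / (M * card I + 1)"
  have pos: "0 < M * card I + 1" using M_nonneg by (simp add: add_nonneg_pos)
  have d: "d > 0" "M * (card I * d) \<le> e"
  proof -
    show "d > 0" using e pos by (simp add: d_def)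
    then have "M * (card I * d) \<le> (M * card I + 1) * d" by (simp add: algebra_simps)
    also have "\<dots> = e" using pos by (simp add: d_def)
    finally show "M * (card I * d) \<le> e" .
  qed
  define q where "q n = restrict (\<lambda>i. \<lfloor>F n i / d\<rfloor>) I" for n
  define K where "K = \<lceil>B / d\<rceil> + 1"
  have q_mem: "q n \<in> PiE I (\<lambda>_. {-K..K})" for n
  proof
    fix i assume "i \<in> I"
    have "(- B) / d \<le> F n i / d" "F n i / d \<le> B / d"
      by (intro divide_right_mono; use bounded[of n i] d(1) in linarith)+
    then have "-(B / d) \<le> F n i / d" "F n i / d \<le> B / d" by simp_all
    then show "q n i \<in> {-K..K}" unfolding q_def K_def using \<open>i \<in> I\<close> by simp linarith
  qed (simp add: q_def)
  have "finite (range q)"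
    by (rule finite_subset[of _ "PiE I (\<lambda>_. {-K..K})"]) (use q_mem finite_I in \<open>auto intro: finite_PiE\<close>)
  then have "\<not> inj q" using finite_imageD infinite_UNIV_nat by blast
  then obtain m n where mn: "m < n" "q m = q n" by (metis injI linorder_neqE_nat)
  have close: "\<bar>F m i - F n i\<bar> \<le> d" if "i \<in> I" for i
  proof -
    have "\<lfloor>F m i / d\<rfloor> = \<lfloor>F n i / d\<rfloor>" using fun_cong[OF mn(2), of i] that by (simp add: q_def)
    then have "\<bar>F m i / d - F n i / d\<bar> < 1" by linarith
    then show ?thesis using d(1) by (simp add: diff_divide_distrib[symmetric])
  qed
  have "\<bar>F m y - F n y\<bar> \<le> e" for y
  proof -
    have "\<bar>F m y - F n y\<bar> \<le> M * (\<Sum>x\<in>I. \<bar>F m x - F n x\<bar>)"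
      using abs_le_nodes[OF diff_mem[OF F F]] by simp
    also have "\<dots> \<le> M * (card I * d)"
      by (intro mult_left_mono M_nonneg sum_bounded_above close)
    finally show ?thesis using d(2) by linarith
  qed
  then show ?thesis using mn(1) by blast
qed

end

section \<open>The action of SU on rays\<close>

definition cip :: "complex^'n \<Rightarrow> complex^'n \<Rightarrow> complex" where
  "cip x y = (\<Sum>i\<in>UNIV. cnj (x$i) * y$i)"

text \<open>An arbitrary representative. Formulas in its coordinates define the intended functions
  on rays when they are invariant under phases, such as those with equal degree in the coordinates
  and in their conjugates.\<close>

definition vec_of :: "('n::finite) ray \<Rightarrow> complex^'n" where
  "vec_of r = (SOME \<psi>. norm \<psi> = 1 \<and> ray_of \<psi> = r)"

definition act :: "complex^('n::finite)^'n \<Rightarrow> 'n ray \<Rightarrow> 'n ray" where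
  "act U r = ray_of (U *v vec_of r)"

lemma cip_diff_left: "cip (x - y) z = cip x z - cip y z"
  by (simp add: cip_def left_diff_distrib sum_subtractf)

lemma cip_diff_right: "cip x (y - z) = cip x y - cip x z"
  by (simp add: cip_def right_diff_distrib sum_subtractf)

lemma cip_add_right: "cip x (y + z) = cip x y + cip x z"
  by (simp add: cip_def distrib_left sum.distrib)

lemma cip_add_left: "cip (x + y) z = cip x z + cip y z"
  by (simp add: cip_def distrib_right sum.distrib)

lemma cip_scale_right: "cip x (c *s y) = c * cip x y"
  by (simp add: cip_def sum_distrib_left mult_ac)

lemma cip_scale_left: "cip (c *s x) y = cnj c * cip x y"
  by (simp add: cip_def sum_distrib_left mult_ac)

lemma cnj_cip: "cnj (cip x y) = cip y x"
  by (simp add: cip_def mult.commute)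

lemma cip_self: "cip x x = of_real ((norm x)\<^sup>2)"
proof -
  have "(norm x)\<^sup>2 = (\<Sum>i\<in>UNIV. (norm (x$i))\<^sup>2)"
    by (simp add: norm_vec_def L2_set_def sum_nonneg)
  moreover have "cnj (x$i) * x$i = of_real ((norm (x$i))\<^sup>2)" for i
    by (metis complex_norm_square mult.commute)
  ultimately show ?thesis by (simp only: cip_def of_real_sum)
qed

lemma norm_eq_if_cip: "cip x x = cip y y \<Longrightarrow> norm x = norm y"
  unfolding cip_self of_real_eq_iff by simp

lemma cip_axis: "cip (axis i 1) x = x$i"
proof -
  have "cip (axis i 1) x = (\<Sum>j\<in>UNIV. if j = i then x$i else 0)"
    unfolding cip_def by (intro sum.cong) (auto simp: axis_def)
  then show ?thesis by simp
qed

lemma norm_scale_unit: "norm c = 1 \<Longrightarrow> norm (c *s x) = norm (x :: complex^'n)"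
  by (rule norm_eq_if_cip) (simp add: cip_scale_left cip_scale_right mult.assoc[symmetric]
      complex_norm_square[symmetric])

lemma Rep_ray_of: "norm \<psi> = 1 \<Longrightarrow> Rep_ray (ray_of \<psi>) = proj \<psi>"
  unfolding ray_of_def by (rule Abs_ray_inverse) blast

lemma vec_of: "norm (vec_of r) = 1" "ray_of (vec_of r) = r"
proof -
  obtain \<psi> where "Rep_ray r = proj \<psi>" "norm \<psi> = 1" using Rep_ray[of r] by blast
  then have "norm \<psi> = 1 \<and> ray_of \<psi> = r" by (metis Rep_ray_inverse ray_of_def)
  then have "norm (vec_of r) = 1 \<and> ray_of (vec_of r) = r" unfolding vec_of_def by (rule someI)
  then show "norm (vec_of r) = 1" "ray_of (vec_of r) = r" by auto
qed

lemma ray_of_scale: "norm c = 1 \<Longrightarrow> ray_of (c *s x) = ray_of x"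
proof -
  assume "norm c = 1"
  then have "c * cnj c = 1" by (simp add: complex_norm_square[symmetric])
  then have "proj (c *s x) = proj x"
    by (simp add: proj_def vec_eq_iff)
  then show ?thesis by (simp add: ray_of_def)
qed

lemma proj_matrix_cong: "proj x = proj y \<Longrightarrow> proj (U *v x) = proj (U *v y)"
proof -
  assume eq: "proj x = proj y"
  have "(U *v z)$i * cnj ((U *v z)$j) = (\<Sum>k\<in>UNIV. \<Sum>l\<in>UNIV. U$i$k * cnj (U$j$l) * proj z$k$l)" for z i j
    by (simp add: matrix_vector_mult_def sum_product proj_def mult_ac)
  then show ?thesis unfolding proj_def[of "U *v x"] proj_def[of "U *v y"] by (simp add: eq)
qed

lemma ray_of_eqD: "ray_of x = ray_of y \<Longrightarrow> norm x = 1 \<Longrightarrow> norm y = 1 \<Longrightarrow> proj x = proj y"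
  by (metis Rep_ray_of)

section \<open>Unitary matrices and the determinant\<close>

definition unitary :: "complex^('n::finite)^'n \<Rightarrow> bool" where
  "unitary U \<longleftrightarrow> cadjoint U ** U = mat 1"

lemma cip_matrix_left: "cip (A *v x) y = cip x (cadjoint A *v y)"
proof -
  have "cip (A *v x) y = (\<Sum>i\<in>UNIV. \<Sum>j\<in>UNIV. cnj (A$i$j) * cnj (x$j) * y$i)"
    by (simp add: cip_def matrix_vector_mult_def sum_distrib_right)
  also have "\<dots> = (\<Sum>j\<in>UNIV. \<Sum>i\<in>UNIV. cnj (A$i$j) * cnj (x$j) * y$i)" by (rule sum.swap)
  also have "\<dots> = cip x (cadjoint A *v y)"
    by (simp add: cip_def matrix_vector_mult_def cadjoint_def sum_distrib_left mult_ac)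
  finally show ?thesis .
qed

lemma unitary_cip: "unitary U \<Longrightarrow> cip (U *v x) (U *v y) = cip x y"
  by (simp add: unitary_def cip_matrix_left matrix_vector_mul_assoc)

lemma unitary_norm: "unitary U \<Longrightarrow> norm (U *v x) = norm x"
  by (rule norm_eq_if_cip) (rule unitary_cip)

lemma unitaryI:
  fixes U :: "complex^'n^'n"
  assumes "\<And>x y. cip (U *v x) (U *v y) = cip x y"
  shows "unitary U"
proof -
  have "(cadjoint U ** U)$i$j = (mat 1 :: complex^'n^'n)$i$j" for i j :: 'n
  proof -
    have "(cadjoint U ** U)$i$j = cip (U *v axis i 1) (U *v axis j 1)"
    proof -
      have "(U *v axis m 1)$k = U$k$m" for k m
        by (simp add: matrix_vector_mult_def axis_def if_distrib[of "\<lambda>t. _ * t"] cong: if_cong)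
      then show ?thesis by (simp add: cip_def matrix_matrix_mult_def cadjoint_def)
    qed
    also have "\<dots> = (mat 1 :: complex^'n^'n)$i$j"
      by (simp add: assms cip_axis) (simp add: axis_def mat_def)
    finally show ?thesis .
  qed
  then show ?thesis by (simp add: unitary_def vec_eq_iff)
qed

lemma unitary_mult: "unitary U \<Longrightarrow> unitary W \<Longrightarrow> unitary (U ** W)"
  by (rule unitaryI) (simp add: matrix_vector_mul_assoc[symmetric] unitary_cip)

lemma mat_mult_vec: "mat c *v x = c *s (x :: complex^'n)"
  by (simp add: vec_eq_iff matrix_vector_mult_def mat_def if_distrib[of "\<lambda>t. t * _"] cong: if_cong)

lemma unitary_mat: "norm c = 1 \<Longrightarrow> unitary (mat c)"
  by (rule unitaryI) (simp add: mat_mult_vec cip_scale_left cip_scale_right mult.assoc[symmetric]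
      complex_norm_square[symmetric])

lemma det_cadjoint: "det (cadjoint U) = cnj (det (U :: complex^'n^'n))"
proof -
  have "det (cadjoint U) = det (transpose (\<chi> i j. cnj (U$i$j)))"
    by (simp add: cadjoint_def transpose_def)
  also have "\<dots> = det (\<chi> i j. cnj (U$i$j))" by (rule det_transpose)
  also have "\<dots> = cnj (det U)" by (simp add: det_def)
  finally show ?thesis .
qed

lemma unitary_norm_det: "unitary U \<Longrightarrow> norm (det U) = 1"
proof -
  assume "unitary U"
  then have "cnj (det U) * det U = 1"
    by (metis unitary_def det_mul det_I det_cadjoint)
  then have "complex_of_real ((norm (det U))\<^sup>2) = 1" by (metis complex_norm_square mult.commute)
  then have "(norm (det U))\<^sup>2 = 1" by (metis of_real_eq_1_iff)
  then show ?thesis by (simp add: power2_eq_1_iff) (metis norm_ge_zero neg_0_le_iff_le not_one_le_zero)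
qed

text \<open>Scalar phases act trivially on rays, so constructions may ignore the determinant and
  correct it at the end by a root of its inverse of order the dimension.\<close>

lemma unitary_phase_SU:
  fixes U :: "complex^'n^'n"
  assumes U: "unitary U"
  shows "\<exists>c. norm c = 1 \<and> mat c ** U \<in> SU"
proof -
  define c where "c = cis (- Arg (det U) / CARD('n))"
  have c: "norm c = 1" by (simp add: c_def)
  have "det U \<noteq> 0" using unitary_norm_det[OF U] by auto
  then have "det U = cis (Arg (det U))"
    using cis_Arg unitary_norm_det[OF U] by (metis sgn_div_norm scaleR_one inverse_1)
  moreover have "c ^ CARD('n) = cis (- Arg (det U))" by (simp add: c_def Complex.DeMoivre del: minus_divide_left)
  moreover have "det (mat c :: complex^'n^'n) = c ^ CARD('n)"
    by (subst det_diagonal) (simp_all add: mat_def)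
  ultimately have "det (mat c ** U) = 1" by (simp add: det_mul) (metis cis_mult add.left_inverse cis_zero)
  then have "mat c ** U \<in> SU"
    using unitary_mult[OF unitary_mat[OF c] U] by (simp add: SU_def unitary_def)
  then show ?thesis using c by blast
qed

text \<open>That vectors orthogonal to \<open>y - y'\<close> stay fixed is what allows a second
  reflection to move \<open>y\<close> without disturbing an already placed \<open>x\<close>.\<close>

lemma complex_reflection:
  fixes y y' :: "complex^'n"
  assumes norms: "norm y = norm y'"
  shows "\<exists>R. unitary R \<and> R *v y = y' \<and> (\<forall>w. cip (y - y') w = 0 \<longrightarrow> R *v w = w)"
proof (cases "y = y'")
  case True
  have "unitary (mat 1 :: complex^'n^'n)" by (rule unitary_mat) simp
  then show ?thesis using True by (intro exI[of _ "mat 1"]) simp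
next
  case False
  (* s is the unique scalar with R y = y', and norm y = norm y' gives
     s + cnj s = |s|^2 |v|^2, which is unitarity of R. *)
  define v where "v = y - y'"
  define t where "t = cip v y"
  define s where "s = 1 / t"
  define R :: "complex^'n^'n" where "R = (\<chi> i j. (if i = j then 1 else 0) - s * v$i * cnj (v$j))"
  have R: "R *v w = w - (s * cip v w) *s v" for w
  proof -
    have "(R *v w)$i = (w - (s * cip v w) *s v)$i" for i
    proof -
      have "(R *v w)$i = (\<Sum>j\<in>UNIV. (if i = j then w$j else 0) - s * v$i * (cnj (v$j) * w$j))"
        unfolding matrix_vector_mult_def R_def by (auto intro!: sum.cong simp: left_diff_distrib)
      also have "\<dots> = (w - (s * cip v w) *s v)$i"
        by (simp add: sum_subtractf sum_distrib_left[symmetric] cip_def)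
      finally show ?thesis .
    qed
    then show ?thesis by (simp add: vec_eq_iff)
  qed
  have "cip y y = cip y' y'" by (simp add: cip_self norms)
  then have vv: "cip v v = t + cnj t"
    by (simp add: t_def v_def cip_diff_left cip_diff_right cnj_cip)
  have "cip v v \<noteq> 0" using False by (simp add: cip_self v_def)
  then have t0: "t \<noteq> 0" using vv by auto
  have s: "s + cnj s = s * cnj s * cip v v" using t0 by (simp add: s_def vv field_simps)
  have "cip (R *v x) (R *v z) = cip x z" for x z
  proof -
    have "cip (R *v x) (R *v z) = cip x z - (s + cnj s) * cip x v * cip v z
        + s * cnj s * cip v v * cip x v * cip v z"
      by (simp add: R cip_diff_left cip_diff_right cip_scale_left cip_scale_right cnj_cip algebra_simps)
    then show ?thesis by (simp add: s)
  qed
  then have "unitary R" by (rule unitaryI)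
  moreover have "R *v y = y'" using t0 by (simp add: R s_def t_def[symmetric]) (simp add: v_def)
  moreover have "R *v w = w" if "cip (y - y') w = 0" for w using that by (simp add: R v_def)
  ultimately show ?thesis by blast
qed

text \<open>One reflection takes \<open>x\<close> to \<open>x'\<close>; a second takes the image
  \<open>y1\<close> of \<open>y\<close> to a phase multiple of \<open>y'\<close> and fixes
  \<open>x'\<close>.\<close>

lemma SU_two_point_transitive:
  fixes x y x' y' :: "complex^'n"
  assumes n: "norm x = 1" "norm y = 1" "norm x' = 1" "norm y' = 1"
    and eq: "norm (cip x y) = norm (cip x' y')"
  shows "\<exists>U\<in>SU. ray_of (U *v x) = ray_of x' \<and> ray_of (U *v y) = ray_of y'"
proof -
  obtain R where R: "unitary R" "R *v x = x'" using complex_reflection[of x x'] n by auto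
  define y1 where "y1 = R *v y"
  have cip1: "norm (cip x' y1) = norm (cip x' y')"
    using unitary_cip[OF R(1), of x y] eq by (simp add: R(2) y1_def)
  \<comment> \<open>The phase makes the inner products of \<open>y1\<close> and
    \<open>c *s y'\<close> with \<open>x'\<close> agree, so their difference is orthogonal to
    \<open>x'\<close>.\<close>
  have "\<exists>c. norm c = 1 \<and> cip x' y1 = c * cip x' y'"
  proof (cases "cip x' y' = 0")
    case True
    then show ?thesis using cip1 by (intro exI[of _ 1]) simp
  next
    case False
    then show ?thesis using cip1
      by (intro exI[of _ "cip x' y1 / cip x' y'"]) (simp add: norm_divide)
  qed
  then obtain c where c: "norm c = 1" "cip x' y1 = c * cip x' y'" by blast
  have "norm y1 = norm (c *s y')"
    using n by (simp add: y1_def unitary_norm[OF R(1)] norm_scale_unit[OF c(1)])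
  then obtain Q where Q: "unitary Q" "Q *v y1 = c *s y'"
    "\<And>w. cip (y1 - c *s y') w = 0 \<Longrightarrow> Q *v w = w"
    using complex_reflection[of y1 "c *s y'"] by blast
  have "cip x' (y1 - c *s y') = 0" by (simp add: cip_diff_right cip_scale_right c(2))
  then have "cip (y1 - c *s y') x' = 0" by (metis cnj_cip complex_cnj_zero)
  then have Qx: "Q *v x' = x'" by (rule Q(3))
  define U where "U = Q ** R"
  have U: "unitary U" "U *v x = x'" "U *v y = c *s y'"
    unfolding U_def using unitary_mult[OF Q(1) R(1)] Q(2) Qx R(2)
    by (simp_all add: matrix_vector_mul_assoc[symmetric] y1_def)
  obtain d where d: "norm d = 1" "mat d ** U \<in> SU" using unitary_phase_SU[OF U(1)] by blast
  show ?thesis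
    by (rule bexI[OF _ d(2)])
      (simp add: matrix_vector_mul_assoc[symmetric] mat_mult_vec U ray_of_scale d c
        vector_smult_assoc norm_mult)
qed

section \<open>Group laws of the action on rays\<close>

lemma SU_unitary: "U \<in> SU \<Longrightarrow> unitary U"
  by (simp add: SU_def unitary_def)

lemma act_ray_of:
  assumes "unitary U" "norm x = 1"
  shows "act U (ray_of x) = ray_of (U *v x)"
proof -
  have "proj (vec_of (ray_of x)) = proj x" by (rule ray_of_eqD) (simp_all add: vec_of assms)
  from proj_matrix_cong[OF this] have "proj (U *v vec_of (ray_of x)) = proj (U *v x)" .
  then show ?thesis unfolding act_def ray_of_def[of "U *v _"] by (rule arg_cong)
qed

lemma act_act: "unitary U \<Longrightarrow> unitary W \<Longrightarrow> act U (act W r) = act (U ** W) r"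
  by (simp add: act_def[of W] act_ray_of unitary_norm vec_of matrix_vector_mul_assoc)
    (simp add: act_def)

lemma act_mat_1: "act (mat 1) r = r"
  by (simp add: act_def vec_of)

lemma SU_mult: "U \<in> SU \<Longrightarrow> W \<in> SU \<Longrightarrow> U ** W \<in> SU"
  using unitary_mult[of U W] by (simp add: SU_def unitary_def det_mul)

lemma cadjoint_cadjoint: "cadjoint (cadjoint U) = U"
  by (simp add: cadjoint_def vec_eq_iff)

lemma SU_inverse:
  assumes "U \<in> SU"
  shows "cadjoint U \<in> SU" "cadjoint U ** U = mat 1" "U ** cadjoint U = mat 1"
proof -
  show 1: "cadjoint U ** U = mat 1" using assms by (simp add: SU_def)
  then show 2: "U ** cadjoint U = mat 1" using matrix_left_right_inverse by blast
  show "cadjoint U \<in> SU" using assms 2 by (simp add: SU_def cadjoint_cadjoint det_cadjoint)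
qed

lemma SU_one: "mat 1 \<in> SU"
  using unitary_mat[of 1] by (simp add: SU_def unitary_def)

section \<open>Functions with finitely many Fourier coefficients\<close>

lemma cos_add_multiple:
  "cos x * cos (real (Suc m) * x) = (cos (real (Suc (Suc m)) * x) + cos (real m * x)) / 2"
proof -
  have "cos (real (Suc (Suc m)) * x) = cos (real (Suc m) * x + x)"
    "cos (real m * x) = cos (real (Suc m) * x - x)" by (simp_all add: algebra_simps)
  then show ?thesis by (simp only: cos_add cos_diff) (simp add: field_simps)
qed

text \<open>These are the Chebyshev polynomials, obtained from their three-term recurrence.\<close>

lemma cos_multiple_polynomial: "\<exists>Q :: real poly. \<forall>x. cos (real m * x) = poly Q (cos x)"
proof (induction m rule: less_induct)
  case (less m)
  consider "m = 0" | "m = 1" | n where "m = Suc (Suc n)" by (metis One_nat_def not0_implies_Suc)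
  then show ?case
  proof cases
    case 1
    then show ?thesis by (intro exI[of _ 1]) simp
  next
    case 2
    then show ?thesis by (intro exI[of _ "[:0, 1:]"]) simp
  next
    case 3
    obtain P Q :: "real poly" where PQ: "\<And>x. cos (real (Suc n) * x) = poly P (cos x)"
        "\<And>x. cos (real n * x) = poly Q (cos x)"
      using less[of "Suc n"] less[of n] 3 by auto
    have "cos (real m * x) = poly ([:0, 2:] * P - Q) (cos x)" for x
    proof -
      have "cos (real m * x) = 2 * (cos x * cos (real (Suc n) * x)) - cos (real n * x)"
        unfolding 3 cos_add_multiple by (simp add: field_simps)
      then show ?thesis by (simp add: PQ del: of_nat_Suc)
    qed
    then show ?thesis by blast
  qed
qed

lemma integral_cos_int:
  "integral {0..2*pi} (\<lambda>x. cos (of_int k * x)) = (if k = 0 then 2 * pi else 0)"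
proof (cases "k = 0")
  case False
  have "((\<lambda>x. cos (of_int k * x)) has_integral (sin (of_int k * (2*pi)) / k - sin (of_int k * 0) / k)) {0..2*pi}"
  proof (rule fundamental_theorem_of_calculus)
    fix x :: real
    have "((\<lambda>x. sin (of_int k * x) / k) has_real_derivative cos (of_int k * x)) (at x within {0..2*pi})"
      using False by (auto intro!: derivative_eq_intros)
    then show "((\<lambda>x. sin (of_int k * x) / k) has_vector_derivative cos (of_int k * x)) (at x within {0..2*pi})"
      by (simp add: has_real_derivative_iff_has_vector_derivative)
  qed simp
  moreover have "sin (of_int k * (2*pi)) = 0"
    by (metis mult.commute sin_int_2pin)
  ultimately show ?thesis using False by (simp add: integral_unique)
qed simp

lemma integral_cos_cos:
  "integral {0..2*pi} (\<lambda>x. cos (real m * x) * cos (real n * x))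
    = (if m = n then if m = 0 then 2 * pi else pi else 0)"
proof -
  have int: "(\<lambda>x. cos (of_int k * x)) integrable_on {0..2*pi}" for k
    by (intro integrable_continuous_interval continuous_intros)
  have "cos (real m * x) * cos (real n * x)
      = (cos (of_int (int m - int n) * x) + cos (of_int (int m + int n) * x)) / 2" for x
    by (simp add: cos_times_cos algebra_simps)
  then have "integral {0..2*pi} (\<lambda>x. cos (real m * x) * cos (real n * x))
     = integral {0..2*pi} (\<lambda>x. (cos (of_int (int m - int n) * x) + cos (of_int (int m + int n) * x)) / 2)"
    by (simp only:)
  also have "\<dots> = (integral {0..2*pi} (\<lambda>x. cos (of_int (int m - int n) * x))
        + integral {0..2*pi} (\<lambda>x. cos (of_int (int m + int n) * x))) / 2"
    unfolding integral_divide by (subst integral_add[OF int int]) (rule refl)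
  finally show ?thesis unfolding integral_cos_int by auto
qed

theorem polynomial_if_finite_Fourier_support:
  fixes R :: "real \<Rightarrow> real"
  assumes contR: "continuous_on {-1..1} R"
    and fin: "finite {m::nat. integral {0..2*pi} (\<lambda>x. R (cos x) * cos (real m * x)) \<noteq> 0}"
  shows "\<exists>Q. \<forall>c\<in>{-1..1}. R c = poly Q c"
proof -
  define c where "c m = integral {0..2*pi} (\<lambda>x. R (cos x) * cos (real m * x))" for m :: nat
  \<comment> \<open>The integral of the square of \<open>cos (m x)\<close> over a period.\<close>
  define n where "n m = (if m = 0 then 2 * pi else pi)" for m :: nat
  define S where "S = {m. c m \<noteq> 0}"
  have finS: "finite S" using fin by (simp add: S_def c_def)
  have n0: "n m \<noteq> 0" for m by (simp add: n_def)
  obtain T :: "nat \<Rightarrow> real poly" where T: "\<And>m x. cos (real m * x) = poly (T m) (cos x)"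
    using cos_multiple_polynomial by metis
  define Q where "Q = (\<Sum>m\<in>S. smult (c m / n m) (T m))"
  define R' where "R' y = R y - poly Q y" for y
  have contR': "continuous_on {-1..1} R'"
    unfolding R'_def by (intro continuous_intros contR)
  have comp: "continuous_on A (\<lambda>x. f (cos x))" if "continuous_on {-1..1} f" for A :: "real set" and f :: "real \<Rightarrow> real"
    by (rule continuous_on_compose2[OF that]) (auto intro: continuous_intros)
  have int: "(\<lambda>x. f (cos x) * g x) integrable_on {0..2*pi}"
    if "continuous_on {-1..1} f" "continuous_on UNIV g" for f g :: "real \<Rightarrow> real"
    by (intro integrable_continuous_interval continuous_intros comp[OF that(1)]
        continuous_on_subset[OF that(2)]) auto
  have zero: "integral {0..2*pi} (\<lambda>x. R' (cos x) * cos (real m * x)) = 0" for m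
  proof -
    have "integral {0..2*pi} (\<lambda>x. R' (cos x) * cos (real m * x))
      = integral {0..2*pi} (\<lambda>x. R (cos x) * cos (real m * x) - (\<Sum>k\<in>S. (c k / n k) * (cos (real k * x) * cos (real m * x))))"
      by (intro arg_cong[where f = "integral _"] ext)
        (simp add: R'_def Q_def poly_sum T[symmetric] left_diff_distrib sum_distrib_right mult.assoc)
    also have "\<dots> = c m - (\<Sum>k\<in>S. (c k / n k) * integral {0..2*pi} (\<lambda>x. cos (real k * x) * cos (real m * x)))"
      unfolding c_def[of m]
      by (subst integral_diff, intro int contR continuous_intros,
          intro integrable_continuous_interval continuous_intros,
          subst integral_sum[OF finS], intro integrable_continuous_interval continuous_intros, simp)
    also have "(\<Sum>k\<in>S. (c k / n k) * integral {0..2*pi} (\<lambda>x. cos (real k * x) * cos (real m * x)))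
       = (\<Sum>k\<in>S. if k = m then c m else 0)"
      unfolding integral_cos_cos using n0 by (intro sum.cong) (auto simp: n_def)
    also have "\<dots> = c m" using finS by (simp add: S_def)
    finally show ?thesis by simp
  qed
  \<comment> \<open>Multiplication by \<open>cos x\<close> replaces the frequency \<open>m\<close>
    by \<open>m - 1\<close> and \<open>m + 1\<close>, so the moments for \<open>j + 1\<close> follow
    from those for \<open>j\<close>; frequency 0 gives frequency 1 alone.\<close>
  have zero_power: "integral {0..2*pi} (\<lambda>x. (R' (cos x) * cos x ^ j) * cos (real m * x)) = 0" for j m
  proof (induction j arbitrary: m)
    case 0
    show ?case using zero by simp
  next
    case (Suc j)
    show ?case
    proof (cases m)
      case 0
      then show ?thesis using Suc[of 1] by (simp add: mult_ac)
    next
      case (Suc m')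
      have "(R' (cos x) * cos x ^ Suc j) * cos (real m * x)
          = ((R' (cos x) * cos x ^ j) * cos (real (Suc m) * x) + (R' (cos x) * cos x ^ j) * cos (real m' * x)) / 2" for x
      proof -
        have "(R' (cos x) * cos x ^ Suc j) * cos (real m * x) = (R' (cos x) * cos x ^ j) * (cos x * cos (real m * x))"
          by simp
        then show ?thesis unfolding Suc cos_add_multiple by (simp add: distrib_left)
      qed
      then have "integral {0..2*pi} (\<lambda>x. (R' (cos x) * cos x ^ Suc j) * cos (real m * x))
        = (integral {0..2*pi} (\<lambda>x. (R' (cos x) * cos x ^ j) * cos (real (Suc m) * x))
           + integral {0..2*pi} (\<lambda>x. (R' (cos x) * cos x ^ j) * cos (real m' * x))) / 2"
        by (simp only: integral_divide)
          (subst integral_add; intro int[of "\<lambda>y. R' y * y ^ j"] continuous_intros contR' refl)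
      then show ?thesis by (simp only: Suc.IH) simp
    qed
  qed
  have zero_poly: "integral {0..2*pi} (\<lambda>x. R' (cos x) * f (cos x)) = 0"
    if poly_f: "real_polynomial_function f" for f
  proof -
    obtain a N where f: "f = (\<lambda>x. \<Sum>i\<le>N. a i * x^i)"
      using poly_f unfolding real_polynomial_function_iff_sum by blast
    have "integral {0..2*pi} (\<lambda>x. R' (cos x) * f (cos x))
        = integral {0..2*pi} (\<lambda>x. \<Sum>i\<le>N. a i * (R' (cos x) * cos x ^ i))"
      by (simp add: f sum_distrib_left mult_ac)
    also have "\<dots> = (\<Sum>i\<le>N. a i * integral {0..2*pi} (\<lambda>x. R' (cos x) * cos x ^ i))"
      by (subst integral_sum) (auto intro!: integrable_continuous_interval continuous_intros comp[OF contR'])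
    also have "\<dots> = 0" using zero_power[of _ 0] by simp
    finally show ?thesis .
  qed
  define K where "K = integral {0..2*pi} (\<lambda>x. \<bar>R' (cos x)\<bar>)"
  define E where "E = integral {0..2*pi} (\<lambda>x. (R' (cos x))\<^sup>2)"
  have "E \<le> e * K" if e: "e > 0" for e
  proof -
    obtain f where f: "real_polynomial_function f" "\<And>y. y \<in> {-1..1} \<Longrightarrow> \<bar>R' y - f y\<bar> < e"
      using Stone_Weierstrass_real_polynomial_function[OF _ contR' e] by (auto)
    have contf: "continuous_on {-1..1} f"
      by (rule continuous_on_polymonial_function) (use f(1) real_polynomial_function_eq in blast)
    have "E = integral {0..2*pi} (\<lambda>x. (R' (cos x))\<^sup>2) - integral {0..2*pi} (\<lambda>x. R' (cos x) * f (cos x))"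
      by (simp add: E_def zero_poly[OF f(1)])
    also have "\<dots> = integral {0..2*pi} (\<lambda>x. (R' (cos x))\<^sup>2 - R' (cos x) * f (cos x))"
      by (rule integral_diff[symmetric]; intro integrable_continuous_interval continuous_intros comp contR' contf)
    also have "\<dots> \<le> integral {0..2*pi} (\<lambda>x. e * \<bar>R' (cos x)\<bar>)"
    proof (rule integral_le)
      fix x :: real
      have "(R' (cos x))\<^sup>2 - R' (cos x) * f (cos x) = R' (cos x) * (R' (cos x) - f (cos x))"
        by (simp add: power2_eq_square right_diff_distrib)
      also have "\<dots> \<le> \<bar>R' (cos x)\<bar> * \<bar>R' (cos x) - f (cos x)\<bar>" by (metis abs_ge_self abs_mult)
      also have "\<dots> \<le> \<bar>R' (cos x)\<bar> * e" using f(2)[of "cos x"] by (intro mult_left_mono) auto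
      finally show "(R' (cos x))\<^sup>2 - R' (cos x) * f (cos x) \<le> e * \<bar>R' (cos x)\<bar>" by (simp add: mult.commute)
    qed (intro integrable_continuous_interval continuous_intros comp contR' contf)+
    also have "\<dots> = e * K" by (simp add: K_def)
    finally show ?thesis .
  qed
  then have lim: "\<And>e. e > 0 \<Longrightarrow> E \<le> e * K" .
  have "K \<ge> 0" unfolding K_def by (rule integral_nonneg) (intro integrable_continuous_interval continuous_intros comp contR', simp)
  have "E \<le> 0"
  proof (rule field_le_epsilon)
    fix e :: real assume "e > 0"
    have "E \<le> e / (K + 1) * K" using \<open>e > 0\<close> \<open>K \<ge> 0\<close> by (intro lim) simp
    also have "\<dots> \<le> e" using \<open>e > 0\<close> \<open>K \<ge> 0\<close> by (simp add: field_simps)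
    finally show "E \<le> 0 + e" by simp
  qed
  moreover have "E \<ge> 0" unfolding E_def
    by (rule integral_nonneg) (intro integrable_continuous_interval continuous_intros comp contR', simp)
  ultimately have E0: "((\<lambda>x. (R' (cos x))\<^sup>2) has_integral 0) (cbox 0 (2*pi))"
    unfolding has_integral_iff E_def
    by (auto intro!: integrable_continuous_interval continuous_intros comp contR')
  have "R' y = 0" if y: "y \<in> {-1..1}" for y
  proof -
    have "(R' (cos (arccos y)))\<^sup>2 = 0"
      by (rule has_integral_0_cbox_imp_0[OF _ _ E0])
        (use y arccos_lbound[of y] arccos_ubound[of y] in \<open>auto simp: not_le[THEN iffD2, OF pi_gt_zero] intro!: continuous_intros comp contR'\<close>)
    then show ?thesis using y by simp
  qed
  then show ?thesis unfolding R'_def by (intro exI[of _ Q]) auto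
qed

section \<open>Invariant kernels on projective space are polynomial\<close>

lemma norm_cip_le: "norm (cip x y) \<le> norm x * norm y"
proof -
  have "norm (cip x y) \<le> (\<Sum>i\<in>UNIV. norm (x$i) * norm (y$i))"
    unfolding cip_def by (rule order_trans[OF norm_sum]) (simp add: norm_mult)
  also have "\<dots> \<le> L2_set (\<lambda>i. norm (x$i)) UNIV * L2_set (\<lambda>i. norm (y$i)) UNIV"
    using L2_set_mult_ineq[of "\<lambda>i. norm (x$i)" "\<lambda>i. norm (y$i)" UNIV] by simp
  finally show ?thesis by (simp add: norm_vec_def)
qed

lemma norm_1_if_cip: "cip x x = 1 \<Longrightarrow> norm x = 1"
  unfolding cip_self of_real_eq_1_iff by (metis norm_ge_zero power2_eq_1_iff one_neq_neg_one
      abs_norm_cancel abs_neg_one)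

lemma integral_periodic_shift:
  fixes h :: "real \<Rightarrow> real"
  assumes cont: "continuous_on UNIV h" and per: "\<And>s. h (s + 2*pi) = h s"
    and \<beta>: "\<beta> \<in> {0..2*pi}"
  shows "integral {0..2*pi} (\<lambda>x. h (x - \<beta>)) = integral {0..2*pi} h"
proof -
  have int: "h integrable_on {u..v}" for u v
    by (intro integrable_continuous_interval continuous_on_subset[OF cont]) auto
  have shift: "integral {u..v} (\<lambda>x. h (x + d)) = integral {u + d..v + d} h" for u v d
    using integral_shift_Icc_real[of u v h d] by (simp add: o_def add.commute)
  have "integral {0..2*pi} (\<lambda>x. h (x - \<beta>)) = integral {-\<beta>..2*pi - \<beta>} h"
    using shift[of 0 "2*pi" "-\<beta>"] by simp
  also have "\<dots> = integral {-\<beta>..0} h + integral {0..2*pi - \<beta>} h"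
    by (rule Henstock_Kurzweil_Integration.integral_combine[symmetric, OF _ _ int]) (use \<beta> in auto)
  also have "integral {-\<beta>..0} h = integral {2*pi - \<beta>..2*pi} h"
    using shift[of "-\<beta>" 0 "2*pi"] by (simp add: per)
  also have "\<dots> + integral {0..2*pi - \<beta>} h = integral {0..2*pi} h"
    by (subst add.commute, rule Henstock_Kurzweil_Integration.integral_combine[OF _ _ int]) (use \<beta> in auto)
  finally show ?thesis .
qed

text \<open>Three coordinate directions are fixed: pairs of rays are normalised into the plane of
  the first two, and the apex of the isosceles triangle uses the third.\<close>

locale projective_kernel = invariant_function_space V "act ` SU" I L M
  for V :: "(('n::finite) ray \<Rightarrow> real) set" and I L M +
  fixes k :: "'n ray \<Rightarrow> 'n ray \<Rightarrow> real" and B :: real and a b c :: 'n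
  assumes k_mem: "\<And>r. k r \<in> V"
    and k_bound: "\<And>r s. \<bar>k r s\<bar> \<le> B"
    and k_invariant: "\<And>U r s. U \<in> SU \<Longrightarrow> k (act U r) (act U s) = k r s"
    and distinct_indices: "a \<noteq> b" "a \<noteq> c" "b \<noteq> c"
begin

lemma k_cong:
  assumes n: "norm x = 1" "norm y = 1" "norm x' = 1" "norm y' = 1"
    and eq: "norm (cip x y) = norm (cip x' y')"
  shows "k (ray_of x) (ray_of y) = k (ray_of x') (ray_of y')"
proof -
  obtain U where U: "U \<in> SU" "ray_of (U *v x) = ray_of x'" "ray_of (U *v y) = ray_of y'"
    using SU_two_point_transitive[OF n eq] by blast
  show ?thesis
    using k_invariant[OF U(1), of "ray_of x" "ray_of y"] by (simp add: act_ray_of SU_unitary U n)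
qed

text \<open>Sup-norm closeness of the sections of \<open>k\<close>. Single kernel values would not
  do: the sections are what the pigeonhole principle compares and what satisfies a triangle
  inequality.\<close>

definition near :: "real \<Rightarrow> complex^'n \<Rightarrow> complex^'n \<Rightarrow> bool" where
  "near e x y \<longleftrightarrow> (\<forall>s. \<bar>k (ray_of x) s - k (ray_of y) s\<bar> \<le> e)"

lemma near_cong:
  assumes n: "norm x = 1" "norm y = 1" "norm x' = 1" "norm y' = 1"
    and eq: "norm (cip x y) = norm (cip x' y')" and near: "near e x' y'"
  shows "near e x y"
  unfolding near_def
proof
  fix s
  obtain U where U: "U \<in> SU" "ray_of (U *v x) = ray_of x'" "ray_of (U *v y) = ray_of y'"
    using SU_two_point_transitive[OF n eq] by blast
  have "k (ray_of x) s = k (ray_of x') (act U s)" "k (ray_of y) s = k (ray_of y') (act U s)"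
    using k_invariant[OF U(1), of _ s, symmetric] by (simp_all add: act_ray_of SU_unitary U n)
  then show "\<bar>k (ray_of x) s - k (ray_of y) s\<bar> \<le> e" using near by (simp add: near_def)
qed

lemma near_trans:
  assumes "near e x y" "near e' y z"
  shows "near (e + e') x z"
  unfolding near_def
proof
  fix s
  have "\<bar>k (ray_of x) s - k (ray_of y) s\<bar> \<le> e" "\<bar>k (ray_of y) s - k (ray_of z) s\<bar> \<le> e'"
    using assms by (simp_all add: near_def)
  then show "\<bar>k (ray_of x) s - k (ray_of z) s\<bar> \<le> e + e'" by linarith
qed

definition vec3 :: "complex \<Rightarrow> complex \<Rightarrow> complex \<Rightarrow> complex^'n" where
  "vec3 p q r = p *s axis a 1 + q *s axis b 1 + r *s axis c 1"

lemma cip_vec3: "cip (vec3 p q r) (vec3 p' q' r') = cnj p * p' + cnj q * q' + cnj r * r'"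
  using distinct_indices
  by (simp add: vec3_def cip_add_left cip_add_right cip_scale_left cip_scale_right cip_axis)
    (simp add: axis_def)

(* Two near vectors exist by the pigeonhole principle; by transitivity every pair with the same
   overlap \<tau> is near, and any x, y with overlap at least 2\<tau>^2 - 1 are the base of an
   isosceles triangle whose legs have overlap \<tau>. *)
lemma near_if_cip_near_1:
  assumes e: "e > 0"
  shows "\<exists>\<rho><1. \<forall>x y. norm x = 1 \<longrightarrow> norm y = 1 \<longrightarrow> \<rho> \<le> norm (cip x y) \<longrightarrow> near e x y"
proof -
  \<comment> \<open>Distinct angles in the interval from 0 to 1, so that any two of the vectors have
    overlap strictly between 0 and 1.\<close>
  define t where "t n = 1 / real (Suc n)" for n
  define \<psi> where "\<psi> n = vec3 (cos (t n)) (sin (t n)) 0" for n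
  have cip_\<psi>: "cip (\<psi> m) (\<psi> n) = of_real (cos (t m - t n))" for m n
    by (simp add: \<psi>_def cip_vec3 cos_diff)
  have norm_\<psi>: "norm (\<psi> n) = 1" for n by (rule norm_1_if_cip) (simp add: cip_\<psi>)
  obtain m n where mn: "m < n" "near (e / 2) (\<psi> m) (\<psi> n)"
    using pigeonhole[of "\<lambda>n. k (ray_of (\<psi> n))" B "e / 2"] k_mem k_bound e unfolding near_def by auto
  define \<tau> where "\<tau> = cos (t m - t n)"
  have "t n < t m" "t m \<le> 1" "0 < t n" using mn(1) by (auto simp: t_def field_simps)
  then have t: "0 < t m - t n" "t m - t n < pi / 2" using pi_gt3 by linarith+
  then have \<tau>: "0 < \<tau>" "\<tau> < 1"
    using cos_gt_zero[OF t] cos_monotone_0_pi[of 0 "t m - t n"] by (auto simp: \<tau>_def)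
  have step: "near (e / 2) x y" if "norm x = 1" "norm y = 1" "norm (cip x y) = \<tau>" for x y
    using near_cong[OF that(1,2) norm_\<psi> norm_\<psi> _ mn(2)] that(3) \<tau> by (simp add: cip_\<psi> \<tau>_def)
  show ?thesis
  proof (intro exI[of _ "2 * \<tau>\<^sup>2 - 1"] conjI allI impI)
    show "2 * \<tau>\<^sup>2 - 1 < 1" using \<tau> by (simp add: abs_square_less_1)
    fix x y :: "complex^'n" assume n: "norm x = 1" "norm y = 1" and le: "2 * \<tau>\<^sup>2 - 1 \<le> norm (cip x y)"
    define q where "q = norm (cip x y)"
    have q: "0 \<le> q" "q \<le> 1" using norm_cip_le[of x y] n by (auto simp: q_def)
    \<comment> \<open>With \<open>q\<close> the cosine of an angle, \<open>u\<close> is the tangent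
      of half of it, so \<open>w0\<close> projects onto the bisector of \<open>x0\<close> and
      \<open>y0\<close> and has overlap \<open>\<tau>\<close> with both. The third coordinate
      \<open>w\<close> normalises it; its radicand is nonnegative exactly when
      \<open>2 * \<tau>\<^sup>2 - 1 \<le> q\<close>.\<close>
    define u where "u = sqrt ((1 - q) / (1 + q))"
    have u: "u\<^sup>2 = (1 - q) / (1 + q)" "sqrt (1 - q\<^sup>2) * u = 1 - q"
    proof -
      show "u\<^sup>2 = (1 - q) / (1 + q)" using q by (simp add: u_def)
      have "(1 - q\<^sup>2) * ((1 - q) / (1 + q)) = (1 - q)\<^sup>2"
        using q by (simp add: field_simps power2_eq_square)
      then show "sqrt (1 - q\<^sup>2) * u = 1 - q"
        using q by (simp add: u_def real_sqrt_mult[symmetric])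
    qed
    define w where "w = sqrt (1 - 2 * \<tau>\<^sup>2 / (1 + q))"
    have w: "w\<^sup>2 = 1 - 2 * \<tau>\<^sup>2 / (1 + q)"
      unfolding w_def using q le by (intro real_sqrt_pow2) (simp add: q_def[symmetric] field_simps)
    have q2: "0 \<le> 1 - q\<^sup>2" using q by (simp add: abs_square_le_1)
    define x0 y0 w0 where "x0 = vec3 1 0 0" and "y0 = vec3 q (sqrt (1 - q\<^sup>2)) 0"
      and "w0 = vec3 \<tau> (\<tau> * u) w"
    have cips: "cip x0 x0 = 1" "cip y0 y0 = of_real (q\<^sup>2 + (sqrt (1 - q\<^sup>2))\<^sup>2)"
      "cip w0 w0 = of_real (\<tau>\<^sup>2 + \<tau>\<^sup>2 * u\<^sup>2 + w\<^sup>2)"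
      "cip x0 y0 = of_real q" "cip x0 w0 = of_real \<tau>"
      "cip w0 y0 = of_real (q * \<tau> + \<tau> * (sqrt (1 - q\<^sup>2) * u))"
      by (simp_all add: x0_def y0_def w0_def cip_vec3 power2_eq_square mult_ac del: real_sqrt_mult_self)
    have "q\<^sup>2 + (sqrt (1 - q\<^sup>2))\<^sup>2 = 1" using q2 by simp
    moreover have "\<tau>\<^sup>2 + \<tau>\<^sup>2 * u\<^sup>2 + w\<^sup>2 = 1"
    proof -
      have "(1 - q) / (1 + q) = 2 / (1 + q) - 1" using q by (simp add: field_simps)
      then show ?thesis unfolding u w by (simp only:) (simp add: algebra_simps)
    qed
    ultimately have n0: "norm x0 = 1" "norm y0 = 1" "norm w0 = 1"
      using cips by (auto intro!: norm_1_if_cip)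
    have "q * \<tau> + \<tau> * (sqrt (1 - q\<^sup>2) * u) = \<tau>" unfolding u by (simp add: algebra_simps)
    then have "near (e / 2) w0 y0" using cips \<tau> by (intro step n0) simp
    moreover have "near (e / 2) x0 w0" using cips \<tau> by (intro step n0) simp
    ultimately have "near (e / 2 + e / 2) x0 y0" using near_trans by blast
    then show "near e x y"
      using near_cong[OF n n0(1,2)] cips(4) q by (simp add: q_def)
  qed
qed

text \<open>The kernel as a function of t = 2 |<x, y>|^2 - 1, the cosine of the angle on the Bloch
  sphere. This variable turns it into a function of \<open>cos (\<alpha> - \<beta>)\<close> on
  \<open>circle\<close>.\<close>

definition profile :: "real \<Rightarrow> real" where
  "profile t = k (ray_of (vec3 1 0 0)) (ray_of (vec3 (sqrt ((1 + t) / 2)) (sqrt ((1 - t) / 2)) 0))"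

lemma norm_profile_vec:
  assumes "t \<in> {-1..1}"
  shows "norm (vec3 (sqrt ((1 + t) / 2)) (sqrt ((1 - t) / 2)) 0) = 1"
proof (rule norm_1_if_cip)
  have "cip (vec3 (sqrt ((1 + t) / 2)) (sqrt ((1 - t) / 2)) 0) (vec3 (sqrt ((1 + t) / 2)) (sqrt ((1 - t) / 2)) 0)
    = of_real ((sqrt ((1 + t) / 2))\<^sup>2 + (sqrt ((1 - t) / 2))\<^sup>2)"
    by (simp only: cip_vec3) (simp add: power2_eq_square del: real_sqrt_mult_self)
  also have "(sqrt ((1 + t) / 2))\<^sup>2 + (sqrt ((1 - t) / 2))\<^sup>2 = 1"
    using assms by (simp add: field_simps)
  finally show "cip (vec3 (sqrt ((1 + t) / 2)) (sqrt ((1 - t) / 2)) 0)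
     (vec3 (sqrt ((1 + t) / 2)) (sqrt ((1 - t) / 2)) 0) = 1" by simp
qed

lemma k_profile:
  assumes "norm x = 1" "norm y = 1"
  shows "k (ray_of x) (ray_of y) = profile (2 * (norm (cip x y))\<^sup>2 - 1)"
proof -
  define q where "q = norm (cip x y)"
  have q: "0 \<le> q" "q \<le> 1" using norm_cip_le[of x y] assms by (auto simp: q_def)
  have q2: "q\<^sup>2 \<le> 1" using q by (simp add: abs_square_le_1)
  have t: "2 * q\<^sup>2 - 1 \<in> {-1..1}" using q2 by auto
  have "cip (vec3 1 0 0) (vec3 (sqrt ((1 + (2 * q\<^sup>2 - 1)) / 2)) (sqrt ((1 - (2 * q\<^sup>2 - 1)) / 2)) 0) = of_real q"
    using q by (simp add: cip_vec3)
  then show ?thesis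
    unfolding profile_def q_def[symmetric]
    by (intro k_cong assms norm_profile_vec[OF t] norm_1_if_cip)
      (use q in \<open>simp_all add: cip_vec3 q_def[symmetric]\<close>)
qed

text \<open>\<open>profile s\<close> is the value at one fixed ray of the section at
  \<open>v s\<close>, and the overlap \<open>g s\<close> of \<open>v t\<close> and
  \<open>v s\<close> tends to 1 as \<open>s\<close> tends to \<open>t\<close>; closeness of sections
  then bounds the difference of values.\<close>

lemma continuous_profile: "continuous_on {-1..1} profile"
  unfolding continuous_on_iff
proof (intro ballI allI impI)
  fix t e :: real assume t: "t \<in> {-1..1}" and e: "e > 0"
  define v where "v s = vec3 (sqrt ((1 + s) / 2)) (sqrt ((1 - s) / 2)) 0" for s
  obtain \<rho> where \<rho>: "\<rho> < 1" "\<And>x y. norm x = 1 \<Longrightarrow> norm y = 1 \<Longrightarrow> \<rho> \<le> norm (cip x y) \<Longrightarrow> near (e / 2) x y"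
    using near_if_cip_near_1[of "e / 2"] e by auto
  define g where "g s = sqrt ((1 + t) / 2) * sqrt ((1 + s) / 2) + sqrt ((1 - t) / 2) * sqrt ((1 - s) / 2)" for s
  have cip_v: "cip (v t) (v s) = of_real (g s)" for s by (simp add: v_def cip_vec3 g_def)
  have "isCont g t" unfolding g_def by (intro continuous_intros) auto
  moreover have "g t = 1"
  proof -
    have "sqrt ((1 + t) / 2) * sqrt ((1 + t) / 2) = (1 + t) / 2"
       "sqrt ((1 - t) / 2) * sqrt ((1 - t) / 2) = (1 - t) / 2" using t by simp_all
    then show ?thesis by (simp only: g_def) (simp add: field_simps)
  qed
  ultimately have "\<exists>d>0. \<forall>s. dist s t < d \<longrightarrow> dist (g s) 1 < 1 - \<rho>"
    using \<rho>(1) unfolding continuous_at_eps_delta by (metis diff_gt_0_iff_gt dist_commute)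
  then obtain d where d: "d > 0" "\<And>s. dist s t < d \<Longrightarrow> \<bar>g s - 1\<bar> < 1 - \<rho>" by (auto simp: dist_real_def)
  have "dist (profile s) (profile t) < e" if s: "s \<in> {-1..1}" "dist s t < d" for s
  proof -
    have "\<rho> \<le> norm (cip (v t) (v s))" using d(2)[OF s(2)] by (simp add: cip_v)
    then have near: "near (e / 2) (v t) (v s)"
      unfolding v_def by (rule \<rho>(2)[OF norm_profile_vec[OF t] norm_profile_vec[OF s(1)]])
    have n1: "norm (vec3 1 0 0) = 1" by (rule norm_1_if_cip) (simp add: cip_vec3)
    have swap: "profile s = k (ray_of (v s)) (ray_of (vec3 1 0 0))" if "s \<in> {-1..1}" for s
      unfolding profile_def v_def
      by (rule k_cong[OF n1 norm_profile_vec[OF that] norm_profile_vec[OF that] n1])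
        (metis cnj_cip complex_mod_cnj)
    show ?thesis using near e unfolding near_def swap[OF s(1)] swap[OF t] dist_real_def
      by (smt (verit, best) field_sum_of_halves)
  qed
  then show "\<exists>d>0. \<forall>s\<in>{-1..1}. dist s t < d \<longrightarrow> dist (profile s) (profile t) < e" using d(1) by blast
qed

text \<open>The equator of the Bloch sphere of the first two coordinates; on it the kernel is a
  convolution kernel.\<close>

definition circle :: "real \<Rightarrow> complex^'n" where
  "circle \<alpha> = vec3 (cis \<alpha> / sqrt 2) (1 / sqrt 2) 0"

lemma cip_circle: "cip (circle \<alpha>) (circle \<beta>) = (cis (\<beta> - \<alpha>) + 1) / 2"
proof -
  have "cip (circle \<alpha>) (circle \<beta>) = (cis (-\<alpha>) * cis \<beta> + 1) / (of_real (sqrt 2 * sqrt 2))"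
    by (simp add: circle_def cip_vec3 cis_cnj add_divide_distrib del: real_sqrt_mult_self)
  then show ?thesis by (simp add: cis_mult)
qed

lemma norm_circle: "norm (circle \<alpha>) = 1"
  by (rule norm_1_if_cip) (simp add: cip_circle)

lemma norm_cip_circle: "2 * (norm (cip (circle \<alpha>) (circle \<beta>)))\<^sup>2 - 1 = cos (\<alpha> - \<beta>)"
proof -
  have "(norm (cis (\<beta> - \<alpha>) + 1))\<^sup>2 = (cos (\<beta> - \<alpha>) + 1)\<^sup>2 + (sin (\<beta> - \<alpha>))\<^sup>2"
    by (simp add: cmod_power2)
  also have "\<dots> = ((sin (\<beta> - \<alpha>))\<^sup>2 + (cos (\<beta> - \<alpha>))\<^sup>2) + 2 * cos (\<beta> - \<alpha>) + 1"
    by (simp only: power2_eq_square) (simp add: algebra_simps)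
  also have "\<dots> = 2 + 2 * cos (\<alpha> - \<beta>)"
    using cos_minus[of "\<alpha> - \<beta>"] unfolding sin_cos_squared_add by simp
  finally show ?thesis by (simp add: cip_circle norm_divide power_divide) (simp add: field_simps)
qed

lemma continuous_circle: "continuous_on A (\<lambda>\<alpha>. k (ray_of (circle \<alpha>)) s)"
proof -
  define u where "u = vec_of s"
  have u: "norm u = 1" "s = ray_of u" by (simp_all add: u_def vec_of)
  have "(\<lambda>\<alpha>. k (ray_of (circle \<alpha>)) s) = (\<lambda>\<alpha>. profile (2 * (norm (cip (circle \<alpha>) u))\<^sup>2 - 1))"
    by (simp add: u k_profile norm_circle)
  moreover have "continuous_on A (\<lambda>\<alpha>. cip (circle \<alpha>) u)"
    by (simp add: circle_def vec3_def cip_add_left cip_scale_left)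
      (intro continuous_intros, auto)
  moreover have "2 * (norm (cip (circle \<alpha>) u))\<^sup>2 - 1 \<in> {-1..1}" for \<alpha>
    using norm_cip_le[of "circle \<alpha>" u] by (simp add: u norm_circle abs_square_le_1)
  ultimately show ?thesis
    by (simp only:) (rule continuous_on_compose2[OF continuous_profile], intro continuous_intros, auto)
qed

section \<open>Fourier coefficients along the circle\<close>

definition coef :: "nat \<Rightarrow> real" where
  "coef m = integral {0..2*pi} (\<lambda>x. profile (cos x) * cos (real m * x))"

definition harmonic :: "nat \<Rightarrow> 'n ray \<Rightarrow> real" where
  "harmonic m s = integral {0..2*pi} (\<lambda>\<alpha>. k (ray_of (circle \<alpha>)) s * cos (real m * \<alpha>))"

text \<open>Interpolation is a finite sum over the nodes and commutes with the integral.\<close>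

lemma harmonic_mem: "harmonic m \<in> V"
proof (rule mem_if_interpolated)
  fix y
  have "harmonic m y = integral {0..2*pi} (\<lambda>\<alpha>. \<Sum>i\<in>I. (k (ray_of (circle \<alpha>)) i * cos (real m * \<alpha>)) * L i y)"
    unfolding harmonic_def
    by (subst interpolate[OF k_mem]) (simp add: sum_distrib_right mult.assoc mult.commute[of "L _ _"])
  also have "\<dots> = (\<Sum>i\<in>I. harmonic m i * L i y)"
    unfolding harmonic_def
    by (subst integral_sum[OF finite_I])
      (auto intro!: integrable_continuous_interval continuous_intros continuous_circle)
  finally show "harmonic m y = (\<Sum>i\<in>I. harmonic m i * L i y)" .
qed

lemma continuous_profile_cos: "continuous_on A (\<lambda>x. profile (cos x))"
  by (rule continuous_on_compose2[OF continuous_profile]) (auto intro: continuous_intros)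

(* Summing over \<beta> and -\<beta> cancels the sine coefficients. *)
lemma harmonic_circle:
  assumes \<beta>: "\<beta> \<in> {0..2*pi}"
  shows "harmonic m (ray_of (circle \<beta>)) + harmonic m (ray_of (circle (2*pi - \<beta>))) = 2 * coef m * cos (real m * \<beta>)"
proof -
  have int: "(\<lambda>x. profile (cos x) * cos (real m * (x + \<gamma>))) integrable_on {0..2*pi}" for \<gamma>
    by (intro integrable_continuous_interval continuous_intros continuous_profile_cos)
  have per: "cos (real m * (x + 2 * pi)) = cos (real m * x)" for x
  proof -
    have "real m * (x + 2 * pi) = real m * x + 2 * pi * real_of_int (int m)" by (simp add: algebra_simps)
    then show ?thesis by (simp only: cos_add cos_int_2pin sin_int_2pin)
  qed
  have one: "harmonic m (ray_of (circle \<gamma>)) = integral {0..2*pi} (\<lambda>x. profile (cos x) * cos (real m * (x + \<gamma>)))"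
    if \<gamma>: "\<gamma> \<in> {0..2*pi}" for \<gamma>
  proof -
    have "harmonic m (ray_of (circle \<gamma>))
      = integral {0..2*pi} (\<lambda>\<alpha>. profile (cos (\<alpha> - \<gamma>)) * cos (real m * ((\<alpha> - \<gamma>) + \<gamma>)))"
      by (simp add: harmonic_def k_profile norm_circle norm_cip_circle)
    also have "\<dots> = integral {0..2*pi} (\<lambda>x. profile (cos x) * cos (real m * (x + \<gamma>)))"
    proof (rule integral_periodic_shift[OF _ _ \<gamma>])
      show "continuous_on UNIV (\<lambda>x. profile (cos x) * cos (real m * (x + \<gamma>)))"
        by (intro continuous_intros continuous_profile_cos)
      fix s
      show "profile (cos (s + 2*pi)) * cos (real m * (s + 2*pi + \<gamma>)) = profile (cos s) * cos (real m * (s + \<gamma>))"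
        using per[of "s + \<gamma>"] by (simp add: add_ac)
    qed
    finally show ?thesis .
  qed
  have trig: "profile (cos x) * cos (real m * (x + \<beta>)) + profile (cos x) * cos (real m * (x + (2*pi - \<beta>)))
      = (2 * cos (real m * \<beta>)) * (profile (cos x) * cos (real m * x))" for x
  proof -
    have "cos (real m * (x + (2*pi - \<beta>))) = cos (real m * x - real m * \<beta>)"
      using per[of "x - \<beta>"] by (simp add: algebra_simps)
    moreover have "cos (real m * (x + \<beta>)) = cos (real m * x + real m * \<beta>)" by (simp add: algebra_simps)
    ultimately show ?thesis by (simp only: cos_add cos_diff) (simp add: algebra_simps)
  qed
  have "2*pi - \<beta> \<in> {0..2*pi}" using \<beta> by auto
  then have "harmonic m (ray_of (circle \<beta>)) + harmonic m (ray_of (circle (2*pi - \<beta>)))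
     = integral {0..2*pi} (\<lambda>x. profile (cos x) * cos (real m * (x + \<beta>)) + profile (cos x) * cos (real m * (x + (2*pi - \<beta>))))"
    using \<beta> by (simp only: one integral_add[OF int int])
  then show ?thesis unfolding trig coef_def by simp
qed

text \<open>Symmetrised on the circle, \<open>harmonic m\<close> is a multiple of
  \<open>cos (m \<beta>)\<close>, nonzero when \<open>coef m\<close> is. Orthogonality of the
  cosines makes these functions independent in \<open>V\<close>, so there are at most
  \<open>card I\<close> of them.\<close>

lemma finite_coef_support: "finite {m. coef m \<noteq> 0}"
proof (rule ccontr)
  assume "infinite {m. coef m \<noteq> 0}"
  then obtain T where T: "T \<subseteq> {m. coef m \<noteq> 0}" "finite T" "card T = Suc (card I)"
    using infinite_arbitrarily_large by metis
  have "card T \<le> card I"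
  proof (rule independent_family(3)[OF T(2)])
    show "harmonic m \<in> V" for m by (rule harmonic_mem)
    fix w j assume w: "\<And>y. (\<Sum>m\<in>T. w m * harmonic m y) = 0" and j: "j \<in> T"
    have "(\<Sum>m\<in>T. (2 * w m * coef m) * cos (real m * \<beta>)) = 0" if "\<beta> \<in> {0..2*pi}" for \<beta>
    proof -
      have "(\<Sum>m\<in>T. (2 * w m * coef m) * cos (real m * \<beta>))
        = (\<Sum>m\<in>T. w m * (harmonic m (ray_of (circle \<beta>)) + harmonic m (ray_of (circle (2*pi - \<beta>)))))"
        by (intro sum.cong refl) (simp add: harmonic_circle[OF that])
      also have "\<dots> = 0" by (simp add: distrib_left sum.distrib w)
      finally show ?thesis .
    qed
    then have "integral {0..2*pi} (\<lambda>\<beta>. (\<Sum>m\<in>T. (2 * w m * coef m) * cos (real m * \<beta>)) * cos (real j * \<beta>))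
       = integral {0..2*pi} (\<lambda>\<beta>. 0)"
      by (intro integral_cong) simp
    also have "(\<lambda>\<beta>. (\<Sum>m\<in>T. (2 * w m * coef m) * cos (real m * \<beta>)) * cos (real j * \<beta>))
       = (\<lambda>\<beta>. \<Sum>m\<in>T. (2 * w m * coef m) * (cos (real m * \<beta>) * cos (real j * \<beta>)))"
      by (simp add: sum_distrib_right mult.assoc)
    also have "integral {0..2*pi} \<dots> = (\<Sum>m\<in>T. (2 * w m * coef m) * integral {0..2*pi} (\<lambda>\<beta>. cos (real m * \<beta>) * cos (real j * \<beta>)))"
      by (subst integral_sum[OF T(2)]) (auto intro!: integrable_continuous_interval continuous_intros)
    also have "\<dots> = (\<Sum>m\<in>T. if m = j then 2 * w j * coef j * (if j = 0 then 2 * pi else pi) else 0)"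
      by (intro sum.cong refl) (simp only: integral_cos_cos, simp)
    also have "\<dots> = 2 * w j * coef j * (if j = 0 then 2 * pi else pi)" using j T(2) by simp
    finally show "w j = 0" using T(1) j by (auto split: if_splits)
  qed
  then show False using T(3) by simp
qed

theorem kernel_polynomial:
  "\<exists>P. \<forall>x y. norm x = 1 \<longrightarrow> norm y = 1 \<longrightarrow> k (ray_of x) (ray_of y) = poly P ((norm (cip x y))\<^sup>2)"
proof -
  obtain Q where Q: "\<And>c. c \<in> {-1..1} \<Longrightarrow> profile c = poly Q c"
    using polynomial_if_finite_Fourier_support[OF continuous_profile] finite_coef_support
    unfolding coef_def by blast
  show ?thesis
  proof (intro exI[of _ "pcompose Q [:-1, 2:]"] allI impI)
    fix x y :: "complex^'n" assume n: "norm x = 1" "norm y = 1"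
    have "(norm (cip x y))\<^sup>2 \<le> 1" using norm_cip_le[of x y] n by (simp add: abs_square_le_1)
    then show "k (ray_of x) (ray_of y) = poly (pcompose Q [:-1, 2:]) ((norm (cip x y))\<^sup>2)"
      using Q[of "2 * (norm (cip x y))\<^sup>2 - 1"] by (simp add: k_profile n poly_pcompose algebra_simps)
  qed
qed

end

section \<open>Born forms and coefficient extraction\<close>

lemma matrix_mult_add_left: "(A + B) ** C = A ** C + B ** (C :: 'a::semiring_1^'n^'m)"
  by (simp add: matrix_matrix_mult_def vec_eq_iff distrib_right sum.distrib)

lemma born_form_add: "born_form f \<Longrightarrow> born_form g \<Longrightarrow> born_form (f + g)"
proof -
  assume "born_form f" "born_form g"
  then obtain H K where "hermitian H" "\<And>r. complex_of_real (f r) = trace (H ** Rep_ray r)"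
     "hermitian K" "\<And>r. complex_of_real (g r) = trace (K ** Rep_ray r)"
    unfolding born_form_def by blast
  then show ?thesis unfolding born_form_def
    by (intro exI[of _ "H + K"])
      (simp add: hermitian_def cadjoint_def vec_eq_iff trace_add matrix_mult_add_left)
qed

lemma born_form_scale: "born_form f \<Longrightarrow> born_form (fscale c f)"
proof -
  assume "born_form f"
  then obtain H where H: "hermitian H" "\<And>r. complex_of_real (f r) = trace (H ** Rep_ray r)"
    unfolding born_form_def by blast
  have "hermitian (c *\<^sub>R H)"
    using H(1) by (simp add: hermitian_def cadjoint_def vec_eq_iff)
  moreover have "trace ((c *\<^sub>R H) ** Rep_ray r) = c *\<^sub>R trace (H ** Rep_ray r)" for r
    by (simp add: trace_def matrix_matrix_mult_def scaleR_sum_right)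
  ultimately show ?thesis unfolding born_form_def fscale_def
    by (intro exI[of _ "c *\<^sub>R H"]) (simp add: H(2)[symmetric] scaleR_conv_of_real)
qed

lemma born_form_zero: "born_form 0"
  unfolding born_form_def
  by (intro exI[of _ 0]) (simp add: hermitian_def cadjoint_def vec_eq_iff trace_def matrix_matrix_mult_def)

lemma born_form_span:
  assumes "\<And>f. f \<in> S \<Longrightarrow> born_form f" "f \<in> fspan S"
  shows "born_form f"
  using assms(2)
proof (induction rule: fs.span_induct_alt)
  case base
  show ?case by (rule born_form_zero)
next
  case (step c x y)
  then show ?case by (blast intro: born_form_add born_form_scale assms(1))
qed

lemma mat_mult_entry: "(mat c ** A)$i$j = c * A$i$j" for A :: "'a::semiring_1^'n^'m"
  unfolding matrix_matrix_mult_def mat_def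
  by (simp add: if_distrib[of "\<lambda>t. t * _"] cong: if_cong)

lemma trace_mat_proj: "trace (mat c ** proj v) = c * cip v v"
proof -
  have "trace (mat c ** proj v) = (\<Sum>i\<in>UNIV. c * (v$i * cnj (v$i)))"
    unfolding trace_def mat_mult_entry by (simp add: proj_def)
  then show ?thesis by (simp add: cip_def sum_distrib_left mult_ac)
qed

lemma trace_proj_proj: "trace (proj x ** proj v) = of_real ((norm (cip x v))\<^sup>2)"
proof -
  have "trace (proj x ** proj v) = (\<Sum>i\<in>UNIV. \<Sum>j\<in>UNIV. (cnj (x$j) * v$j) * cnj (cnj (x$i) * v$i))"
    by (simp add: trace_def matrix_matrix_mult_def proj_def mult_ac)
  also have "\<dots> = cip x v * cnj (cip x v)"
    unfolding cip_def cnj_sum sum_product by (rule sum.swap)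
  finally have "trace (proj x ** proj v) = cip x v * cnj (cip x v)" .
  then show ?thesis by (simp only: complex_norm_square)
qed

text \<open>On unit vectors the constant is the trace against a multiple of the identity and the
  squared overlap is the trace against the projector of \<open>x\<close>.\<close>

lemma born_form_affine:
  fixes f :: "('n::finite) ray \<Rightarrow> real"
  assumes "\<And>r. f r = \<alpha> + \<beta> * (norm (cip x (vec_of r)))\<^sup>2"
  shows "born_form f"
  unfolding born_form_def
proof (intro exI conjI allI)
  let ?H = "mat (complex_of_real \<alpha>) + mat (complex_of_real \<beta>) ** proj x :: complex^'n^'n"
  have entry: "(mat (complex_of_real \<beta>) ** proj x :: complex^'n^'n)$i$j = of_real \<beta> * (x$i * cnj (x$j))" for i j
    unfolding mat_mult_entry by (simp add: proj_def)
  show "hermitian ?H"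
    by (auto simp: hermitian_def cadjoint_def vec_eq_iff entry) (auto simp: mat_def mult_ac)
  fix r :: "'n ray"
  have R: "Rep_ray r = proj (vec_of r)" using Rep_ray_of[of "vec_of r"] by (simp add: vec_of)
  have "trace (?H ** Rep_ray r) = trace (mat (complex_of_real \<alpha>) ** proj (vec_of r))
     + trace (mat (complex_of_real \<beta>) ** (proj x ** proj (vec_of r)))"
    unfolding R by (simp add: matrix_mult_add_left trace_add matrix_mul_assoc)
  also have "trace (mat (complex_of_real \<beta>) ** (proj x ** proj (vec_of r))) = \<beta> * trace (proj x ** proj (vec_of r))"
    unfolding trace_def mat_mult_entry by (simp add: sum_distrib_left)
  finally show "complex_of_real (f r) = trace (?H ** Rep_ray r)"
    by (simp add: trace_mat_proj trace_proj_proj cip_self vec_of assms)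
qed

section \<open>Extracting coefficients from finitely many evaluations\<close>

lemma coeff_mult_at_bound:
  fixes p q :: "'a::comm_semiring_1 poly"
  assumes "degree p \<le> m" "degree q \<le> n"
  shows "coeff (p * q) (m + n) = coeff p m * coeff q n"
proof -
  have "coeff (p * q) (m + n) = (\<Sum>i\<le>m + n. if i = m then coeff p m * coeff q n else 0)"
    unfolding coeff_mult
  proof (rule sum.cong[OF refl])
    fix i assume "i \<in> {..m + n}"
    show "coeff p i * coeff q (m + n - i) = (if i = m then coeff p m * coeff q n else 0)"
    proof (cases i m rule: linorder_cases)
      case less
      then show ?thesis using assms(2) by (simp add: coeff_eq_0)
    next
      case greater
      then show ?thesis using assms(1) by (simp add: coeff_eq_0)
    qed simp
  qed
  then show ?thesis by simp
qed

text \<open>A fixed degree bound replaces the leading coefficient, since the polynomials will depend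
  on a ray and their top terms may vanish at some rays.\<close>

lemma coeff_power_at_bound:
  fixes p :: "'a::comm_semiring_1 poly"
  assumes "degree p \<le> d"
  shows "coeff (p ^ l) (d * l) = coeff p d ^ l" "degree (p ^ l) \<le> d * l"
proof -
  have "coeff (p ^ l) (d * l) = coeff p d ^ l \<and> degree (p ^ l) \<le> d * l"
  proof (induction l)
    case (Suc l)
    then show ?case
      using coeff_mult_at_bound[OF assms, of "p ^ l" "d * l"] degree_mult_le[of p "p ^ l"] assms
      by auto
  qed simp
  then show "coeff (p ^ l) (d * l) = coeff p d ^ l" "degree (p ^ l) \<le> d * l" by auto
qed

lemma degree_linear_power: "degree ([:a, b:] ^ n) \<le> n" for a :: "'a::comm_semiring_1"
proof -
  have "degree [:a, b:] \<le> 1" by simp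
  from coeff_power_at_bound(2)[OF this, of n] show ?thesis by simp
qed

lemma coeff_1_mult: "coeff (p * q) (Suc 0) = coeff p 0 * coeff q 1 + coeff p 1 * coeff q 0"
  by (simp add: coeff_mult)

lemma coeff_0_linear_power: "coeff ([:a, b:] ^ n) 0 = (a::'a::comm_semiring_1) ^ n"
  by (induction n) (simp_all add: coeff_mult)

lemma coeff_1_linear_power:
  "coeff ([:a, b:] ^ Suc n) (Suc 0) = of_nat (Suc n) * (a::'a::comm_semiring_1) ^ n * b"
proof (induction n)
  case (Suc n)
  have "coeff ([:a, b:] ^ Suc (Suc n)) (Suc 0) = a * coeff ([:a, b:] ^ Suc n) (Suc 0) + b * a ^ Suc n"
    by (simp only: power_Suc[of _ "Suc n"] coeff_1_mult coeff_0_linear_power) simp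
  then show ?case unfolding Suc by (simp add: algebra_simps)
qed simp

text \<open>Vandermonde elimination: the evaluation for \<open>Suc r\<close> minus
  \<open>\<omega> ^ Suc n\<close> times the one for \<open>r\<close> removes the top coefficient and
  multiplies each other one by a nonzero scalar.\<close>

lemma coefficient_extraction:
  fixes W :: "('x \<Rightarrow> complex) set"
  assumes add: "\<And>f g. f \<in> W \<Longrightarrow> g \<in> W \<Longrightarrow> (\<lambda>x. f x + g x) \<in> W"
    and scale: "\<And>f c. f \<in> W \<Longrightarrow> (\<lambda>x. c * f x) \<in> W"
    and inj: "inj_on (\<lambda>i. \<omega> ^ i) {..n}"
    and mem: "\<And>r. (\<lambda>x. \<Sum>i\<le>n. (\<omega> ^ r) ^ i * h i x) \<in> W"
    and j: "j \<le> n"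
  shows "h j \<in> W"
  using inj mem j
proof (induction n arbitrary: h j)
  case 0
  then show ?case using "0.prems"(2)[of 0] by simp
next
  case (Suc n)
  have low: "h i \<in> W" if i: "i \<le> n" for i
  proof -
    define h' where "h' i x = (\<omega> ^ i - \<omega> ^ Suc n) * h i x" for i x
    have "h' i \<in> W"
    proof (rule Suc.IH[OF _ _ i])
      show "inj_on (\<lambda>i. \<omega> ^ i) {..n}" by (rule inj_on_subset[OF Suc.prems(1)]) auto
      fix r
      have "(\<Sum>i\<le>n. (\<omega> ^ r) ^ i * h' i x)
        = (\<Sum>i\<le>Suc n. (\<omega> ^ Suc r) ^ i * h i x) + (- (\<omega> ^ Suc n)) * (\<Sum>i\<le>Suc n. (\<omega> ^ r) ^ i * h i x)" for x
      proof -
        have "(\<Sum>i\<le>Suc n. (\<omega> ^ Suc r) ^ i * h i x) + (- (\<omega> ^ Suc n)) * (\<Sum>i\<le>Suc n. (\<omega> ^ r) ^ i * h i x)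
          = (\<Sum>i\<le>Suc n. (\<omega> ^ r) ^ i * h' i x)"
          unfolding sum_distrib_left sum.distrib[symmetric]
          by (rule sum.cong[OF refl]) (simp add: h'_def power_mult_distrib algebra_simps)
        then show ?thesis by (simp add: h'_def)
      qed
      then show "(\<lambda>x. \<Sum>i\<le>n. (\<omega> ^ r) ^ i * h' i x) \<in> W"
        using add[OF Suc.prems(2)[of "Suc r"] scale[OF Suc.prems(2)[of r], of "- (\<omega> ^ Suc n)"]] by simp
    qed
    moreover have "\<omega> ^ i - \<omega> ^ Suc n \<noteq> 0"
      using inj_onD[OF Suc.prems(1), of i "Suc n"] i by auto
    then have "h i = (\<lambda>x. (1 / (\<omega> ^ i - \<omega> ^ Suc n)) * h' i x)" by (simp add: h'_def)
    ultimately show ?thesis using scale by metis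
  qed
  show ?case
  proof (cases "j \<le> n")
    case False
    then have j: "j = Suc n" using Suc.prems(3) by simp
    have zero: "(\<lambda>x. 0) \<in> W" using scale[OF low[of 0], of 0] by simp
    have sum: "(\<lambda>x. \<Sum>i\<in>A. h i x) \<in> W" if "A \<subseteq> {..n}" "finite A" for A
      using that(2,1) by (induction A rule: finite_induct) (auto intro: zero add low)
    have "h j = (\<lambda>x. (\<Sum>i\<le>Suc n. (\<omega> ^ 0) ^ i * h i x) + (-1) * (\<Sum>i\<le>n. h i x))"
      by (simp add: j)
    then show ?thesis using add[OF Suc.prems(2)[of 0] scale[OF sum[of "{..n}"], of "-1"]] by simp
  qed (rule low)
qed

lemma polynomial_coefficient_extraction:
  fixes W :: "('x \<Rightarrow> complex) set"
  assumes add: "\<And>f g. f \<in> W \<Longrightarrow> g \<in> W \<Longrightarrow> (\<lambda>x. f x + g x) \<in> W"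
    and scale: "\<And>f c. f \<in> W \<Longrightarrow> (\<lambda>x. c * f x) \<in> W"
    and inj: "inj_on (\<lambda>i. \<omega> ^ i) {..n}"
    and degree: "\<And>x. degree (Q x) \<le> n"
    and mem: "\<And>r. (\<lambda>x. poly (Q x) (\<omega> ^ r)) \<in> W"
    and j: "j \<le> n"
  shows "(\<lambda>x. coeff (Q x) j) \<in> W"
proof (rule coefficient_extraction[OF add scale inj _ j, where h = "\<lambda>i x. coeff (Q x) i"])
  fix r
  have "poly (Q x) z = (\<Sum>i\<le>n. z ^ i * coeff (Q x) i)" for x z
    unfolding poly_altdef using degree[of x]
    by (intro sum.mono_neutral_cong_left) (auto simp: coeff_eq_0)
  then show "(\<lambda>x. \<Sum>i\<le>n. (\<omega> ^ r) ^ i * coeff (Q x) i) \<in> W" using mem[of r] by simp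
qed

text \<open>The parameter in \<open>top_power_mem\<close> must have modulus one for \<open>x\<close>
  to be a unit vector of the right form, hence roots of unity. The parameters in
  \<open>determinant_mem\<close> are free, and powers of 2 suffice.\<close>

lemma root_of_unity_powers_inj: "inj_on (\<lambda>i. cis (2 * pi / real (Suc n)) ^ i) {..n}"
proof (rule inj_onI)
  fix i j assume ij: "i \<in> {..n}" "j \<in> {..n}"
    and eq: "cis (2 * pi / real (Suc n)) ^ i = cis (2 * pi / real (Suc n)) ^ j"
  have "cis (2 * pi / real (Suc n)) ^ i = exp (2 * of_real pi * \<i> * of_nat i / of_nat (Suc n))" for i
    unfolding cis_conv_exp exp_of_nat_mult[symmetric]
    by (rule arg_cong[where f = exp]) (simp add: mult_ac)
  with eq have "i mod Suc n = j mod Suc n"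
    using complex_root_unity_eq[of "Suc n" i j] by (simp only:)
  then show "i = j" using ij by simp
qed

lemma two_powers_inj: "inj_on (\<lambda>i. (2::complex) ^ i) {..n}"
proof (rule inj_onI)
  fix i j :: nat assume "(2::complex) ^ i = 2 ^ j"
  then have "(2::nat) ^ i = 2 ^ j"
    by (metis of_nat_eq_iff of_nat_numeral of_nat_power)
  then show "i = j" by simp
qed

section \<open>Functions generated by a polynomial kernel\<close>

locale polynomial_kernel_space =
  fixes V :: "(('n::finite) ray \<Rightarrow> real) set" and P :: "real poly"
  assumes V_add: "\<And>f g. f \<in> V \<Longrightarrow> g \<in> V \<Longrightarrow> (\<lambda>r. f r + g r) \<in> V"
    and V_scale: "\<And>f t. f \<in> V \<Longrightarrow> (\<lambda>r. t * f r) \<in> V"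
    and kernel_mem: "\<And>x. norm x = 1 \<Longrightarrow> (\<lambda>r. poly P ((norm (cip x (vec_of r)))\<^sup>2)) \<in> V"
begin

definition complexification :: "('n ray \<Rightarrow> complex) set" where
  "complexification = {h. (\<lambda>r. Re (h r)) \<in> V \<and> (\<lambda>r. Im (h r)) \<in> V}"

lemma complexification_add:
  "f \<in> complexification \<Longrightarrow> g \<in> complexification \<Longrightarrow> (\<lambda>r. f r + g r) \<in> complexification"
  by (simp add: complexification_def V_add)

lemma complexification_scale:
  "f \<in> complexification \<Longrightarrow> (\<lambda>r. t * f r) \<in> complexification"
proof -
  assume "f \<in> complexification"
  then have f: "(\<lambda>r. Re (f r)) \<in> V" "(\<lambda>r. Im (f r)) \<in> V" by (simp_all add: complexification_def)
  have "(\<lambda>r. Re t * Re (f r) + (- Im t) * Im (f r)) \<in> V" "(\<lambda>r. Re t * Im (f r) + Im t * Re (f r)) \<in> V"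
    by (intro V_add V_scale f)+
  then show ?thesis by (simp add: complexification_def)
qed

lemma extraction:
  assumes "inj_on (\<lambda>i. \<omega> ^ i) {..n}" and "\<And>r. degree (Q r) \<le> n"
    and "\<And>m. (\<lambda>r. poly (Q r) (\<omega> ^ m)) \<in> complexification" and "j \<le> n"
  shows "(\<lambda>r. coeff (Q r) j) \<in> complexification"
proof (rule polynomial_coefficient_extraction[OF _ _ assms])
  show "(\<lambda>r. f r + g r) \<in> complexification" if "f \<in> complexification" "g \<in> complexification" for f g
    by (rule complexification_add[OF that])
  show "(\<lambda>r. t * f r) \<in> complexification" if "f \<in> complexification" for f t
    by (rule complexification_scale[OF that])
qed

lemma of_real_mem: "f \<in> V \<Longrightarrow> (\<lambda>r. complex_of_real (f r)) \<in> complexification"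
  using V_scale[of f 0] by (simp add: complexification_def)

text \<open>For \<open>x\<close> proportional to \<open>cnj z *s u + axis c 1\<close> with |z| = 1,
  the squared overlap is \<open>D\<close> times A + z w + cnj(z w). Its image under P is a Laurent
  polynomial in z whose top coefficient is a nonzero multiple of w^N.\<close>

lemma top_power_mem:
  fixes u :: "complex^'n" and c :: 'n
  assumes u: "u$c = 0" and P: "P \<noteq> 0"
  shows "(\<lambda>r. (cip u (vec_of r) * cnj (vec_of r $ c)) ^ degree P) \<in> complexification"
proof -
  define N where "N = degree P"
  \<comment> \<open>The inverse squared norm of \<open>cnj z *s u + axis c 1\<close>, the same for
    all unit \<open>z\<close> because \<open>u$c = 0\<close>.\<close>
  define D where "D = 1 / (1 + (norm u)\<^sup>2)"
  have pos: "1 + (norm u)\<^sup>2 > 0" by (simp add: add_pos_nonneg)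
  then have D0: "D \<noteq> 0" by (simp add: D_def)
  define w where "w r = cip u (vec_of r) * cnj (vec_of r $ c)" for r
  define A where "A r = complex_of_real ((norm (cip u (vec_of r)))\<^sup>2 + (norm (vec_of r $ c))\<^sup>2)" for r
  \<comment> \<open>On the unit circle \<open>cnj z\<close> is the inverse of \<open>z\<close>, so
    \<open>T r\<close> at \<open>z\<close> is \<open>z\<close> times the overlap divided by
    \<open>D\<close>.\<close>
  define T where "T r = [:cnj (w r), A r, w r:]" for r
  define p where "p l = complex_of_real (coeff P l * D ^ l)" for l
  \<comment> \<open>\<open>z ^ N\<close> times the kernel value; the monomial supplies the powers of
    \<open>z\<close> not absorbed by \<open>T r ^ l\<close>, and only \<open>l = N\<close> reaches
    degree \<open>2 * N\<close>.\<close>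
  define Q where "Q r = (\<Sum>l\<le>N. smult (p l) (monom 1 (N - l) * T r ^ l))" for r
  have degT: "degree (T r) \<le> 2" for r by (simp add: T_def)
  have deg_term: "degree (monom (1::complex) (N - l) * T r ^ l) \<le> N + l" if "l \<le> N" for l r
  proof -
    have "degree (monom (1::complex) (N - l) * T r ^ l) \<le> (N - l) + 2 * l"
      using degree_mult_le[of "monom (1::complex) (N - l)" "T r ^ l"]
        coeff_power_at_bound(2)[OF degT, of r l] degree_monom_le[of "1::complex" "N - l"] by linarith
    then show ?thesis using that by simp
  qed
  have degQ: "degree (Q r) \<le> 2 * N" for r
    unfolding Q_def
  proof (rule degree_sum_le)
    fix l assume l: "l \<in> {..N}"
    have "degree (smult (p l) (monom 1 (N - l) * T r ^ l)) \<le> degree (monom 1 (N - l) * T r ^ l)"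
      by (rule degree_smult_le)
    with deg_term[of l r] l show "degree (smult (p l) (monom 1 (N - l) * T r ^ l)) \<le> 2 * N" by simp
  qed simp
  have topQ: "coeff (Q r) (2 * N) = p N * w r ^ N" for r
  proof -
    have "coeff (Q r) (2 * N) = (\<Sum>l\<le>N. if l = N then p N * w r ^ N else 0)"
      unfolding Q_def coeff_sum
    proof (rule sum.cong[OF refl])
      fix l assume l: "l \<in> {..N}"
      show "coeff (smult (p l) (monom 1 (N - l) * T r ^ l)) (2 * N) = (if l = N then p N * w r ^ N else 0)"
      proof (cases "l = N")
        case True
        have "coeff (T r ^ N) (2 * N) = w r ^ N"
          unfolding coeff_power_at_bound(1)[OF degT] by (simp add: T_def numeral_2_eq_2)
        then show ?thesis by (simp add: True monom_0)
      next
        case False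
        then show ?thesis using deg_term[of l r] l by (simp add: coeff_eq_0)
      qed
    qed
    then show ?thesis by simp
  qed
  define \<omega> where "\<omega> = cis (2 * pi / real (Suc (2 * N)))"
  have "(\<lambda>r. poly (Q r) (\<omega> ^ s)) \<in> complexification" for s
  proof -
    define z where "z = \<omega> ^ s"
    have z: "norm z = 1" by (simp add: z_def \<omega>_def norm_power)
    then have zz: "z * cnj z = 1" by (simp add: complex_norm_square[symmetric])
    define y where "y = cnj z *s u + axis c 1"
    define x where "x = of_real (1 / sqrt (1 + (norm u)\<^sup>2)) *s y"
    have sq: "complex_of_real (1 / sqrt (1 + (norm u)\<^sup>2)) * of_real (1 / sqrt (1 + (norm u)\<^sup>2)) = of_real D"
      unfolding of_real_mult[symmetric] using pos by (simp add: D_def real_sqrt_mult[symmetric])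
    have "cip u (axis c 1) = 0" by (subst cnj_cip[symmetric]) (simp add: cip_axis u)
    then have "cip y y = (z * cnj z) * cip u u + 1"
      by (simp add: y_def cip_add_left cip_add_right cip_scale_left cip_scale_right cip_axis u)
    then have "cip x x = of_real D * (cip u u + 1)"
      by (simp add: x_def cip_scale_left cip_scale_right mult.assoc[symmetric] sq zz del: of_real_divide)
    also have "\<dots> = of_real (D * (1 + (norm u)\<^sup>2))" by (simp add: cip_self add.commute)
    also have "\<dots> = 1" using pos by (simp add: D_def)
    finally have nx: "norm x = 1" by (rule norm_1_if_cip)
    have val: "complex_of_real ((norm (cip x (vec_of r)))\<^sup>2) = of_real D * (A r + z * w r + cnj z * cnj (w r))" for r
    proof -
      let ?v = "vec_of r"
      have cx: "cip x ?v = of_real (1 / sqrt (1 + (norm u)\<^sup>2)) * (z * cip u ?v + ?v $ c)"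
        by (simp add: x_def y_def cip_add_left cip_scale_left cip_axis add_divide_distrib)
      have "complex_of_real ((norm (cip x ?v))\<^sup>2) = cip x ?v * cnj (cip x ?v)"
        by (rule complex_norm_square)
      also have "\<dots> = of_real D * ((z * cip u ?v + ?v $ c) * cnj (z * cip u ?v + ?v $ c))"
        unfolding cx complex_cnj_mult complex_cnj_complex_of_real sq[symmetric] by (simp only: mult_ac)
      also have "(z * cip u ?v + ?v $ c) * cnj (z * cip u ?v + ?v $ c)
         = (z * cnj z) * (cip u ?v * cnj (cip u ?v)) + ?v $ c * cnj (?v $ c) + z * w r + cnj z * cnj (w r)"
        by (simp add: w_def algebra_simps)
      also have "\<dots> = A r + z * w r + cnj z * cnj (w r)"
        unfolding zz A_def by (simp only: complex_norm_square of_real_add mult_1)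
      finally show ?thesis .
    qed
    have "poly (Q r) z = z ^ N * complex_of_real (poly P ((norm (cip x (vec_of r)))\<^sup>2))" for r
    proof -
      define t where "t = A r + z * w r + cnj z * cnj (w r)"
      have zt: "poly (T r) z = z * t"
        using zz by (simp add: T_def t_def algebra_simps)
      have "complex_of_real (poly P ((norm (cip x (vec_of r)))\<^sup>2))
         = (\<Sum>l\<le>N. of_real (coeff P l) * (complex_of_real ((norm (cip x (vec_of r)))\<^sup>2)) ^ l)"
        by (simp add: poly_altdef N_def)
      also have "\<dots> = (\<Sum>l\<le>N. p l * t ^ l)"
        unfolding val t_def[symmetric] p_def by (simp add: power_mult_distrib mult_ac)
      finally have "z ^ N * complex_of_real (poly P ((norm (cip x (vec_of r)))\<^sup>2)) = (\<Sum>l\<le>N. z ^ N * (p l * t ^ l))"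
        by (simp only: sum_distrib_left)
      also have "\<dots> = (\<Sum>l\<le>N. p l * (z ^ (N - l) * (z * t) ^ l))"
      proof (rule sum.cong[OF refl])
        fix l assume "l \<in> {..N}"
        then have "z ^ N = z ^ (N - l) * z ^ l" by (simp add: power_add[symmetric])
        then show "z ^ N * (p l * t ^ l) = p l * (z ^ (N - l) * (z * t) ^ l)"
          by (simp add: power_mult_distrib mult_ac)
      qed
      also have "\<dots> = poly (Q r) z"
        by (simp add: Q_def poly_sum poly_monom zt)
      finally show ?thesis by simp
    qed
    then have "(\<lambda>r. poly (Q r) z) = (\<lambda>r. z ^ N * complex_of_real (poly P ((norm (cip x (vec_of r)))\<^sup>2)))"
      by (rule ext)
    then show ?thesis
      unfolding z_def[symmetric] using complexification_scale[OF of_real_mem[OF kernel_mem[OF nx]]] by simp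
  qed
  from extraction[OF root_of_unity_powers_inj[of "2 * N", folded \<omega>_def] degQ this order_refl]
  have "(\<lambda>r. p N * w r ^ N) \<in> complexification" unfolding topQ .
  from complexification_scale[OF this, of "1 / p N"]
  show ?thesis using P D0 by (simp add: p_def N_def w_def)
qed

text \<open>Polarisation: \<open>top_power_mem\<close> supplies powers of all linear forms that
  avoid \<open>v$c\<close>. The linear coefficient in \<open>s\<close> and then in \<open>t\<close>
  of a two-parameter family of them is the required form.\<close>

lemma determinant_mem:
  assumes deg: "degree P = Suc (Suc n)" and c: "c \<notin> {i, j, k, l}"
  shows "(\<lambda>r. let v = vec_of r in
    v$i ^ n * (v$j * v$k - v$i * v$l) * cnj (v$c) ^ Suc (Suc n)) \<in> complexification"
proof -
  (* \<kappa> makes the st-coefficient of (x + s y + t z + s t \<kappa> w)^(n+2) a multiple of yz - xw. *)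
  define \<kappa> where "\<kappa> = (- of_nat (Suc n) :: complex)"
  have P: "P \<noteq> 0" using deg by auto
  have 1: "(\<lambda>r. ((vec_of r $ i + s * vec_of r $ j + t * vec_of r $ k + s * t * \<kappa> * vec_of r $ l)
      * cnj (vec_of r $ c)) ^ Suc (Suc n)) \<in> complexification" for s t :: complex
  proof -
    define u :: "complex^'n" where
      "u = axis i 1 + cnj s *s axis j 1 + cnj t *s axis k 1 + cnj (s * t * \<kappa>) *s axis l 1"
    have "u$c = 0" using c by (simp add: u_def axis_def)
    moreover have "cip u v = v$i + s * v$j + t * v$k + s * t * \<kappa> * v$l" for v
      by (simp add: u_def cip_add_left cip_scale_left cip_axis)
    ultimately show ?thesis using top_power_mem[OF _ P, of u c] by (simp add: deg)
  qed
  have 2: "(\<lambda>r. of_nat (Suc (Suc n)) * ((vec_of r $ i + t * vec_of r $ k) * cnj (vec_of r $ c)) ^ Suc n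
      * ((vec_of r $ j + t * \<kappa> * vec_of r $ l) * cnj (vec_of r $ c))) \<in> complexification" for t :: complex
  proof -
    define Q where "Q r = [:(vec_of r $ i + t * vec_of r $ k) * cnj (vec_of r $ c),
        (vec_of r $ j + t * \<kappa> * vec_of r $ l) * cnj (vec_of r $ c):] ^ Suc (Suc n)" for r
    have deg: "degree (Q r) \<le> Suc (Suc n)" for r
      unfolding Q_def by (rule degree_linear_power)
    have "poly (Q r) s = ((vec_of r $ i + s * vec_of r $ j + t * vec_of r $ k + s * t * \<kappa> * vec_of r $ l)
      * cnj (vec_of r $ c)) ^ Suc (Suc n)" for r s
      unfolding Q_def poly_power by (rule arg_cong[where f = "\<lambda>x. x ^ _"]) (simp add: algebra_simps)
    then have "(\<lambda>r. poly (Q r) (2 ^ m)) \<in> complexification" for m using 1 by (simp only:)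
    from extraction[OF two_powers_inj deg this, of 1]
    show ?thesis by (simp add: Q_def coeff_1_linear_power del: power_Suc of_nat_Suc)
  qed
  have 3: "(\<lambda>r. of_nat (Suc (Suc n)) * of_nat (Suc n) * (vec_of r $ i ^ n *
     (vec_of r $ j * vec_of r $ k - vec_of r $ i * vec_of r $ l) * cnj (vec_of r $ c) ^ Suc (Suc n))) \<in> complexification"
  proof -
    define Q where "Q r = smult (of_nat (Suc (Suc n)))
        ([:vec_of r $ i * cnj (vec_of r $ c), vec_of r $ k * cnj (vec_of r $ c):] ^ Suc n
        * [:vec_of r $ j * cnj (vec_of r $ c), \<kappa> * vec_of r $ l * cnj (vec_of r $ c):])" for r
    have deg: "degree (Q r) \<le> Suc (Suc n)" for r
    proof -
      have "degree ([:a, b:] ^ Suc n * [:a', b':]) \<le> Suc (Suc n)" for a b a' b' :: complex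
        using degree_linear_power[of a b "Suc n"] degree_linear_power[of a' b' 1]
          degree_mult_le[of "[:a, b:] ^ Suc n" "[:a', b':]"] unfolding power_one_right by linarith
      then show ?thesis unfolding Q_def using degree_smult_le order_trans by blast
    qed
    have "poly (Q r) t = of_nat (Suc (Suc n)) * ((vec_of r $ i + t * vec_of r $ k) * cnj (vec_of r $ c)) ^ Suc n
      * ((vec_of r $ j + t * \<kappa> * vec_of r $ l) * cnj (vec_of r $ c))" for r t
    proof -
      have "poly [:vec_of r $ i * cnj (vec_of r $ c), vec_of r $ k * cnj (vec_of r $ c):] t
        = (vec_of r $ i + t * vec_of r $ k) * cnj (vec_of r $ c)"
        "poly [:vec_of r $ j * cnj (vec_of r $ c), \<kappa> * vec_of r $ l * cnj (vec_of r $ c):] t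
        = (vec_of r $ j + t * \<kappa> * vec_of r $ l) * cnj (vec_of r $ c)"
        by (simp_all add: algebra_simps)
      then show ?thesis unfolding Q_def poly_smult poly_mult poly_power by (simp only: mult.assoc)
    qed
    then have "(\<lambda>r. poly (Q r) (2 ^ m)) \<in> complexification" for m using 2 by (simp only:)
    from extraction[OF two_powers_inj deg this, of 1]
    have "(\<lambda>r. coeff (Q r) 1) \<in> complexification" by simp
    moreover have "coeff (Q r) 1 = of_nat (Suc (Suc n)) * of_nat (Suc n) * (vec_of r $ i ^ n *
     (vec_of r $ j * vec_of r $ k - vec_of r $ i * vec_of r $ l) * cnj (vec_of r $ c) ^ Suc (Suc n))" for r
    proof -
      have "coeff (Q r) 1 = of_nat (Suc (Suc n)) *
          ((vec_of r $ i * cnj (vec_of r $ c)) ^ Suc n * (\<kappa> * vec_of r $ l * cnj (vec_of r $ c))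
          + of_nat (Suc n) * (vec_of r $ i * cnj (vec_of r $ c)) ^ n * (vec_of r $ k * cnj (vec_of r $ c))
            * (vec_of r $ j * cnj (vec_of r $ c)))"
        unfolding Q_def One_nat_def coeff_smult coeff_1_mult coeff_0_linear_power coeff_1_linear_power by simp
      then show ?thesis unfolding \<kappa>_def power_mult_distrib power_Suc
        by (simp only:) (simp add: algebra_simps del: of_nat_Suc)
    qed
    ultimately show ?thesis by (simp only:)
  qed
  have "of_nat (Suc (Suc n)) * of_nat (Suc n) \<noteq> (0::complex)" by (simp del: of_nat_Suc)
  with complexification_scale[OF 3, of "1 / (of_nat (Suc (Suc n)) * of_nat (Suc n))"]
  show ?thesis by (simp add: Let_def del: of_nat_Suc power_Suc)
qed

end

section \<open>Product states\<close>

lemma norm_tensor: "norm (tensor \<psi> \<phi>) = norm \<psi> * norm \<phi>"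
  for \<psi> :: "complex^('a::finite)" and \<phi> :: "complex^('b::finite)"
proof -
  have "cip (tensor \<psi> \<phi>) (tensor \<psi> \<phi>)
      = (\<Sum>p\<in>UNIV \<times> UNIV. (cnj (\<psi>$fst p) * \<psi>$fst p) * (cnj (\<phi>$snd p) * \<phi>$snd p))"
    by (simp add: cip_def tensor_def mult_ac)
  also have "\<dots> = cip \<psi> \<psi> * cip \<phi> \<phi>"
    by (simp add: cip_def sum_product sum.cartesian_product case_prod_unfold)
  finally have "complex_of_real ((norm (tensor \<psi> \<phi>))\<^sup>2) = of_real ((norm \<psi> * norm \<phi>)\<^sup>2)"
    by (simp add: cip_self power_mult_distrib)
  then have "(norm (tensor \<psi> \<phi>))\<^sup>2 = (norm \<psi> * norm \<phi>)\<^sup>2" by (simp only: of_real_eq_iff)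
  then show ?thesis by (simp add: power2_eq_iff_nonneg)
qed

lemma proj_eq_phase:
  assumes eq: "proj x = proj y" and x: "x \<noteq> 0"
  shows "\<exists>c. c \<noteq> 0 \<and> x = c *s y"
proof -
  obtain j where j: "x$j \<noteq> 0" using x by (auto simp: vec_eq_iff)
  have e: "x$i * cnj (x$j) = y$i * cnj (y$j)" for i
    using eq by (simp add: proj_def vec_eq_iff)
  define c where "c = cnj (y$j) / cnj (x$j)"
  have "x$i = c * y$i" for i using e[of i] j by (simp add: c_def field_simps)
  then have xc: "x = c *s y" by (simp add: vec_eq_iff)
  moreover have "c \<noteq> 0" using x xc by auto
  ultimately show ?thesis by blast
qed

text \<open>Recording \<open>c \<noteq> 0\<close> is enough, since it will be applied to expressions
  whose vanishing does not depend on scale.\<close>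

lemma vec_of_ray_of_phase:
  assumes "norm x = 1"
  shows "\<exists>c. c \<noteq> 0 \<and> vec_of (ray_of x) = c *s x"
proof (rule proj_eq_phase)
  show "proj (vec_of (ray_of x)) = proj x" by (rule ray_of_eqD) (simp_all add: vec_of assms)
  show "vec_of (ray_of x) \<noteq> 0" using vec_of(1)[of "ray_of x"] by force
qed

section \<open>The span of an OPF set as an invariant function space\<close>

lemma bounded_span:
  assumes "\<And>f. f \<in> S \<Longrightarrow> \<exists>M. \<forall>y. \<bar>f y\<bar> \<le> M" and "f \<in> fspan S"
  shows "\<exists>M. \<forall>y. \<bar>f y :: real\<bar> \<le> M"
  using assms(2)
proof (induction rule: fs.span_induct_alt)
  case base
  show ?case by (intro exI[of _ 0]) simp
next
  case (step c f g)
  obtain M N where "\<forall>y. \<bar>f y\<bar> \<le> M" "\<forall>y. \<bar>g y\<bar> \<le> N" using assms(1)[OF step(1)] step(2) by blast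
  then have "\<bar>(fscale c f + g) y\<bar> \<le> \<bar>c\<bar> * M + N" for y
    unfolding fscale_def plus_fun_def
    by (intro order_trans[OF abs_triangle_ineq] add_mono) (auto simp: abs_mult intro: mult_left_mono)
  then show ?case by blast
qed

lemma fspan_SU_invariant:
  fixes \<F> :: "(('n::finite) ray \<Rightarrow> real) set"
  assumes C1: "C1 \<F>" and U: "U \<in> SU" and f: "f \<in> fspan \<F>"
  shows "(\<lambda>r. f (act U r)) \<in> fspan \<F>"
  using f
proof (induction rule: fs.span_induct_alt)
  case base
  show ?case using fs.span_zero by (simp add: zero_fun_def)
next
  case (step c f g)
  obtain f' where f': "f' \<in> \<F>" "\<And>\<psi>. norm \<psi> = 1 \<Longrightarrow> f' (ray_of \<psi>) = f (ray_of (U *v \<psi>))"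
    using C1 step(1) U unfolding C1_def by blast
  have "f' r = f (act U r)" for r
    using f'(2)[OF vec_of(1)[of r]] by (simp add: vec_of act_def)
  then have "(\<lambda>r. f (act U r)) \<in> fspan \<F>" using f'(1) fs.span_base by (metis ext)
  then have "fscale c (\<lambda>r. f (act U r)) + (\<lambda>r. g (act U r)) \<in> fspan \<F>"
    using step(2) by (intro fs.span_add fs.span_scale)
  moreover have "fscale c (\<lambda>r. f (act U r)) + (\<lambda>r. g (act U r)) = (\<lambda>r. (fscale c f + g) (act U r))"
    by (auto simp: fscale_def)
  ultimately show ?case by (simp only:)
qed

lemma invariant_function_space_fspan:
  fixes \<F> :: "(('n::finite) ray \<Rightarrow> real) set"
  assumes opf: "opf_set \<F>" and C1: "C1 \<F>" and fin: "finiteness_principle \<F>"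
  shows "\<exists>I L M. invariant_function_space (fspan \<F>) (act ` SU) I L M"
proof -
  obtain B where B: "finite B" "fspan \<F> = fspan B" using fin unfolding finiteness_principle_def by blast
  obtain I L where IL: "finite I" "\<forall>x\<in>I. L x \<in> fspan \<F>"
    "\<forall>x\<in>I. \<forall>y\<in>I. L x y = (if x = y then 1 else 0)"
    "\<forall>f\<in>fspan \<F>. \<forall>y. f y = (\<Sum>x\<in>I. f x * L x y)"
    using interpolation_nodes[OF B(1)] unfolding B(2) by blast
  have "\<exists>M. \<forall>y. \<bar>f y\<bar> \<le> M" if "f \<in> \<F>" for f
    using opf that unfolding opf_set_def is_opf_def by (intro exI[of _ 1]) auto
  then have "\<exists>M. \<forall>y. \<bar>L x y\<bar> \<le> M" if "x \<in> I" for x using bounded_span[OF _ IL(2)[rule_format, OF that]] by blast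
  then obtain m where m: "\<And>x y. x \<in> I \<Longrightarrow> \<bar>L x y\<bar> \<le> m x" by metis
  define M where "M = (\<Sum>x\<in>I. \<bar>m x\<bar>)"
  have "invariant_function_space (fspan \<F>) (act ` SU) I L M"
  proof
    show "\<bar>L x y\<bar> \<le> M" if "x \<in> I" for x y
    proof -
      have "\<bar>L x y\<bar> \<le> \<bar>m x\<bar>" using m[OF that, of y] by linarith
      also have "\<dots> \<le> M" unfolding M_def by (rule member_le_sum[OF that _ IL(1)]) auto
      finally show ?thesis .
    qed
    show "0 \<le> M" by (simp add: M_def sum_nonneg)
    show "act ` SU \<noteq> {}" using SU_one by blast
    show "(\<lambda>r. g (h r)) \<in> act ` SU" if gh: "g \<in> act ` SU" "h \<in> act ` SU" for g h :: "'n ray \<Rightarrow> 'n ray"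
    proof -
      obtain U W where UW: "U \<in> SU" "g = act U" "W \<in> SU" "h = act W" using gh by blast
      have "(\<lambda>r. g (h r)) = act (U ** W)" using UW by (auto simp: act_act SU_unitary)
      then show ?thesis using SU_mult[OF UW(1,3)] by blast
    qed
    show "\<exists>h\<in>act ` SU. (\<forall>r. g (h r) = r) \<and> (\<forall>r. h (g r) = r)" if g: "g \<in> act ` SU"
      for g :: "'n ray \<Rightarrow> 'n ray"
    proof -
      obtain U where U: "U \<in> SU" "g = act U" using g by blast
      note inv = SU_inverse[OF U(1)]
      show ?thesis
        by (rule bexI[of _ "act (cadjoint U)"])
          (use inv U in \<open>auto simp: act_act SU_unitary act_mat_1\<close>)
    qed
    show "(\<lambda>r. f (g r)) \<in> fspan \<F>" if "f \<in> fspan \<F>" "g \<in> act ` SU" for f g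
      using that fspan_SU_invariant[OF C1] by blast
  qed (rule fs.subspace_span IL(1) IL(2)[rule_format] IL(3)[rule_format] IL(4)[rule_format]; assumption)+
  then show ?thesis by blast
qed

lemma fspan_polynomial_kernel:
  fixes \<F> :: "(('n::finite) ray \<Rightarrow> real) set" and a b c :: 'n
  assumes "opf_set \<F>" "C1 \<F>" "finiteness_principle \<F>" and distinct: "a \<noteq> b" "a \<noteq> c" "b \<noteq> c"
  shows "\<exists>P. polynomial_kernel_space (fspan \<F>) P \<and>
     fspan \<F> = fspan ((\<lambda>x r. poly P ((norm (cip x (vec_of r)))\<^sup>2)) ` {x. norm x = 1})"
proof -
  obtain I L M where space: "invariant_function_space (fspan \<F>) (act ` SU) I L M"
    using invariant_function_space_fspan[OF assms(1-3)] by blast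
  then interpret invariant_function_space "fspan \<F>" "act ` SU" I L M .
  obtain k B where k: "\<And>x. k x \<in> fspan \<F>" "\<And>x y. \<bar>k x y\<bar> \<le> B"
    "\<And>g x y. g \<in> act ` SU \<Longrightarrow> k (g x) (g y) = k x y" "fspan \<F> = fspan (range k)"
    using invariant_kernel by metis
  interpret projective_kernel "fspan \<F>" I L M k B a b c
    by standard (use k distinct in auto)
  obtain P where P: "\<And>x y. norm x = 1 \<Longrightarrow> norm y = 1 \<Longrightarrow>
      k (ray_of x) (ray_of y) = poly P ((norm (cip x y))\<^sup>2)" using kernel_polynomial by blast
  have k_eq: "k (ray_of x) = (\<lambda>r. poly P ((norm (cip x (vec_of r)))\<^sup>2))" if "norm x = 1" for x
  proof
    fix r
    show "k (ray_of x) r = poly P ((norm (cip x (vec_of r)))\<^sup>2)"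
      using P[OF that vec_of(1)[of r]] by (simp add: vec_of)
  qed
  have "polynomial_kernel_space (fspan \<F>) P"
  proof
    show "(\<lambda>r. poly P ((norm (cip x (vec_of r)))\<^sup>2)) \<in> fspan \<F>" if "norm x = 1" for x
      using k(1)[of "ray_of x"] by (simp add: k_eq[OF that])
  qed (use add_mem scale_mem in blast)+
  moreover have "range k = (\<lambda>x r. poly P ((norm (cip x (vec_of r)))\<^sup>2)) ` {x. norm x = 1}"
  proof
    show "range k \<subseteq> (\<lambda>x r. poly P ((norm (cip x (vec_of r)))\<^sup>2)) ` {x. norm x = 1}"
      using k_eq vec_of by (metis (mono_tags, lifting) image_eqI image_subsetI mem_Collect_eq)
    show "(\<lambda>x r. poly P ((norm (cip x (vec_of r)))\<^sup>2)) ` {x. norm x = 1} \<subseteq> range k"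
      using k_eq by (metis (mono_tags, lifting) image_subsetI mem_Collect_eq rangeI)
  qed
  ultimately show ?thesis using k(4) by metis
qed

lemma degree_ge_2_if_alternative:
  fixes \<F> :: "(('n::finite) ray \<Rightarrow> real) set"
  assumes alt: "alternative \<F>"
    and span: "fspan \<F> = fspan ((\<lambda>x r. poly P ((norm (cip x (vec_of r)))\<^sup>2)) ` {x. norm x = 1})"
  shows "2 \<le> degree P"
proof (rule ccontr)
  assume "\<not> 2 \<le> degree P"
  then have "poly P t = coeff P 0 + coeff P 1 * t" for t
  proof -
    have "poly P t = (\<Sum>i\<le>1. coeff P i * t ^ i)"
      unfolding poly_altdef using \<open>\<not> 2 \<le> degree P\<close>
      by (intro sum.mono_neutral_cong_left) (auto simp: coeff_eq_0)
    then show ?thesis by simp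
  qed
  then have "born_form (\<lambda>r. poly P ((norm (cip x (vec_of r)))\<^sup>2))" for x :: "complex^'n"
    by (intro born_form_affine)
  then have gen: "born_form g" if "g \<in> (\<lambda>x r. poly P ((norm (cip x (vec_of r)))\<^sup>2)) ` {x. norm x = 1}"
    for g :: "'n ray \<Rightarrow> real"
    using that by blast
  have "born_form f" if "f \<in> fspan \<F>" for f
    using gen that[unfolded span] by (rule born_form_span)
  then show False using alt fs.span_base unfolding alternative_def by blast
qed

text \<open>C3 speaks of OPFs only; bilinearity extends it to the spans, one argument at a time.
  Bilinearity is available only inside the spans, so membership is carried through both
  inductions.\<close>

lemma star_product_state:
  fixes FA :: "(('a::finite) ray \<Rightarrow> real) set" and FB :: "(('b::finite) ray \<Rightarrow> real) set"
  assumes bil: "bilinear_product star FA FB FC" and C3: "C3 star FA FB"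
    and f: "f \<in> fspan FA" and g: "g \<in> fspan FB" and n: "norm \<psi> = 1" "norm \<phi> = 1"
  shows "star f g (ray_of (tensor \<psi> \<phi>)) = f (ray_of \<psi>) * g (ray_of \<phi>)"
proof -
  have left: "star (fscale a u + fscale b v) h = fscale a (star u h) + fscale b (star v h)"
    if "u \<in> fspan FA" "v \<in> fspan FA" "h \<in> fspan FB" for u v h a b
    using bil that unfolding bilinear_product_def by blast
  have right: "star u (fscale a v + fscale b h) = fscale a (star u v) + fscale b (star u h)"
    if "u \<in> fspan FA" "v \<in> fspan FB" "h \<in> fspan FB" for u v h a b
    using bil that unfolding bilinear_product_def by blast
  have base: "star u v (ray_of (tensor \<psi> \<phi>)) = u (ray_of \<psi>) * v (ray_of \<phi>)"
    if "u \<in> FA" "v \<in> FB" for u v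
    using C3 that n unfolding C3_def by blast
  have one: "g \<in> fspan FB \<and> star u g (ray_of (tensor \<psi> \<phi>)) = u (ray_of \<psi>) * g (ray_of \<phi>)"
    if u: "u \<in> FA" for u
    using g
  proof (induction rule: fs.span_induct_alt)
    case base
    \<comment> \<open>The linearity law with both scalars 0 gives
      \<open>star u 0 = 0\<close>.\<close>
    have "star u (fscale 0 0 + fscale 0 0) = fscale 0 (star u 0) + fscale 0 (star u 0)"
      by (rule right[OF fs.span_base[OF u] fs.span_zero fs.span_zero])
    then show ?case using fs.span_zero by (simp flip: zero_fun_def)
  next
    case (step c v h)
    have v: "v \<in> fspan FB" by (rule fs.span_base[OF step(1)])
    have h: "h \<in> fspan FB" using step(2) by (rule conjunct1)
    have "star u (fscale c v + fscale 1 h) = fscale c (star u v) + fscale 1 (star u h)"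
      by (rule right[OF fs.span_base[OF u] v h])
    then have "star u (fscale c v + h) (ray_of (tensor \<psi> \<phi>))
        = c * star u v (ray_of (tensor \<psi> \<phi>)) + star u h (ray_of (tensor \<psi> \<phi>))"
      by (simp add: fs.scale_one) (simp add: fscale_def)
    also have "\<dots> = u (ray_of \<psi>) * (fscale c v + h) (ray_of \<phi>)"
      using step(2) base[OF u step(1)] by (simp add: fscale_def algebra_simps)
    finally show ?case using fs.span_add[OF fs.span_scale[OF v] h] by blast
  qed
  have "f \<in> fspan FA \<and> star f g (ray_of (tensor \<psi> \<phi>)) = f (ray_of \<psi>) * g (ray_of \<phi>)"
    using f
  proof (induction rule: fs.span_induct_alt)
    case base
    have "star (fscale 0 0 + fscale 0 0) g = fscale 0 (star 0 g) + fscale 0 (star 0 g)"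
      by (rule left[OF fs.span_zero fs.span_zero g])
    then show ?case using fs.span_zero by (simp flip: zero_fun_def)
  next
    case (step c u v)
    have u: "u \<in> fspan FA" by (rule fs.span_base[OF step(1)])
    have v: "v \<in> fspan FA" using step(2) by (rule conjunct1)
    have "star (fscale c u + fscale 1 v) g = fscale c (star u g) + fscale 1 (star v g)"
      by (rule left[OF u v g])
    then have "star (fscale c u + v) g (ray_of (tensor \<psi> \<phi>))
        = c * star u g (ray_of (tensor \<psi> \<phi>)) + star v g (ray_of (tensor \<psi> \<phi>))"
      by (simp add: fs.scale_one) (simp add: fscale_def)
    also have "\<dots> = (fscale c u + v) (ray_of \<psi>) * g (ray_of \<phi>)"
      using step(2) one[OF step(1)] by (simp add: fscale_def algebra_simps)
    finally show ?case using fs.span_add[OF fs.span_scale[OF u] v] by blast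
  qed
  then show ?thesis by (rule conjunct2)
qed

text \<open>On product states \<open>f\<close> is a sum of d(u, v) u(r) v(q). For fixed
  \<open>q\<close> independence of \<open>A\<close> removes the dependence on \<open>r\<close>, and
  then independence of \<open>B\<close> kills each coefficient.\<close>

lemma zero_if_zero_on_product_states:
  fixes FA :: "(('a::finite) ray \<Rightarrow> real) set" and FB :: "(('b::finite) ray \<Rightarrow> real) set"
    and star :: "('a ray \<Rightarrow> real) \<Rightarrow> ('b ray \<Rightarrow> real) \<Rightarrow> (('a \<times> 'b) ray \<Rightarrow> real)"
  assumes bil: "bilinear_product star FA FB FC" and C3: "C3 star FA FB"
    and A: "findependent A" "A \<subseteq> fspan FA" and B: "findependent B" "B \<subseteq> fspan FB"
    and f: "f \<in> fspan ((\<lambda>(u, v). star u v) ` (A \<times> B))"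
    and zero: "\<And>\<psi> \<phi>. norm \<psi> = 1 \<Longrightarrow> norm \<phi> = 1 \<Longrightarrow> f (ray_of (tensor \<psi> \<phi>)) = 0"
  shows "f = 0"
proof -
  define s where "s = (\<lambda>(u, v). star u v)"
  obtain t c where t: "finite t" "t \<subseteq> s ` (A \<times> B)" "f = (\<Sum>h\<in>t. fscale (c h) h)"
    using f unfolding fs.span_explicit s_def by blast
  obtain T where T: "T \<subseteq> A \<times> B" "inj_on s T" "t = s ` T" using t(2) unfolding subset_image_inj by blast
  have finT: "finite T" using t(1) T finite_image_iff by blast
  \<comment> \<open>Extension by zero from the chosen pairs to the full rectangle
    \<open>TA \<times> TB\<close>, so that the sum can be iterated.\<close>
  define d where "d p = (if p \<in> T then c (s p) else 0)" for p
  define TA TB where "TA = fst ` T" and "TB = snd ` T"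
  have fin: "finite TA" "finite TB" using finT by (simp_all add: TA_def TB_def)
  have TAB: "TA \<subseteq> A" "TB \<subseteq> B" using T(1) by (auto simp: TA_def TB_def)
  have f_eval: "f (ray_of (tensor \<psi> \<phi>)) = (\<Sum>u\<in>TA. \<Sum>v\<in>TB. d (u, v) * (u (ray_of \<psi>) * v (ray_of \<phi>)))"
    if n: "norm \<psi> = 1" "norm \<phi> = 1" for \<psi> \<phi>
  proof -
    have "f (ray_of (tensor \<psi> \<phi>)) = (\<Sum>p\<in>T. c (s p) * s p (ray_of (tensor \<psi> \<phi>)))"
      by (simp add: t(3) T(3) sum.reindex[OF T(2)] sum_fun_apply fscale_def)
    also have "\<dots> = (\<Sum>p\<in>T. d p * (fst p (ray_of \<psi>) * snd p (ray_of \<phi>)))"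
    proof (rule sum.cong[OF refl])
      fix p assume p: "p \<in> T"
      then have "fst p \<in> A" "snd p \<in> B" using T(1) by auto
      then have "fst p \<in> fspan FA" "snd p \<in> fspan FB" using A(2) B(2) by blast+
      then show "c (s p) * s p (ray_of (tensor \<psi> \<phi>)) = d p * (fst p (ray_of \<psi>) * snd p (ray_of \<phi>))"
        using star_product_state[OF bil C3 _ _ n] p by (simp add: d_def s_def case_prod_unfold)
    qed
    also have "\<dots> = (\<Sum>p\<in>TA \<times> TB. d p * (fst p (ray_of \<psi>) * snd p (ray_of \<phi>)))"
    proof (rule sum.mono_neutral_left)
      show "T \<subseteq> TA \<times> TB" by (force simp: TA_def TB_def)
    qed (use fin in \<open>auto simp: d_def\<close>)
    also have "\<dots> = (\<Sum>u\<in>TA. \<Sum>v\<in>TB. d (u, v) * (u (ray_of \<psi>) * v (ray_of \<phi>)))"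
      by (simp add: sum.cartesian_product case_prod_unfold)
    finally show ?thesis .
  qed
  have "d (u, v) = 0" if uv: "u \<in> TA" "v \<in> TB" for u v
  proof -
    have inner: "(\<Sum>v\<in>TB. d (u, v) * v q) = 0" if u: "u \<in> TA" for u q
    proof -
      have "(\<Sum>u\<in>TA. fscale (\<Sum>v\<in>TB. d (u, v) * v q) u) = 0"
      proof
        fix r
        have "(\<Sum>u\<in>TA. \<Sum>v\<in>TB. d (u, v) * (u r * v q)) = 0"
          using f_eval[of "vec_of r" "vec_of q"] zero[of "vec_of r" "vec_of q"] by (simp add: vec_of)
        then show "(\<Sum>u\<in>TA. fscale (\<Sum>v\<in>TB. d (u, v) * v q) u) r = 0 r"
          by (simp add: sum_fun_apply fscale_def sum_distrib_left sum_distrib_right mult_ac)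
      qed
      from fs.independentD[OF A(1) fin(1) TAB(1) this u] show ?thesis .
    qed
    have "(\<Sum>v\<in>TB. fscale (d (u, v)) v) = 0"
      using inner[OF uv(1)] by (auto simp: sum_fun_apply fscale_def)
    from fs.independentD[OF B(1) fin(2) TAB(2) this uv(2)] show ?thesis .
  qed
  then have "c (s p) = 0" if "p \<in> T" for p
    using that by (metis (no_types, lifting) TA_def TB_def d_def image_eqI prod.collapse)
  then show "f = 0"
    unfolding t(3) T(3) sum.reindex[OF T(2)] by (auto intro!: sum.neutral simp: fscale_def)
qed

theorem mainTheorem2:
  fixes F3 :: "(3 ray \<Rightarrow> real) set"
    and F9 :: "((3 \<times> 3) ray \<Rightarrow> real) set"
    and star :: "(3 ray \<Rightarrow> real) \<Rightarrow> (3 ray \<Rightarrow> real) \<Rightarrow> ((3 \<times> 3) ray \<Rightarrow> real)"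
    and B :: "(3 ray \<Rightarrow> real) set"
  assumes "opf_set F3" and "opf_set F9"
    and "alternative F3" and "alternative F9"
    and "bilinear_product star F3 F3 F9"
    and "C1 F3" and "C1 F9"
    and "C2 F3" and "C2 F9"
    and "C3 star F3 F3"
    and "finiteness_principle F3" and "finiteness_principle F9"
    and "findependent B" and "fspan B = fspan F3"
  shows "\<not> (inj_on (\<lambda>(f, g). star f g) (B \<times> B) \<and>
             findependent ((\<lambda>(f, g). star f g) ` (B \<times> B)) \<and>
             fspan ((\<lambda>(f, g). star f g) ` (B \<times> B)) = fspan F9)"
proof
  assume "inj_on (\<lambda>(f, g). star f g) (B \<times> B) \<and>
             findependent ((\<lambda>(f, g). star f g) ` (B \<times> B)) \<and>
             fspan ((\<lambda>(f, g). star f g) ` (B \<times> B)) = fspan F9"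
  then have span9: "fspan ((\<lambda>(f, g). star f g) ` (B \<times> B)) = fspan F9" by blast
  have B: "B \<subseteq> fspan F3" using assms(14) fs.span_superset by blast
  have local_tomography: "f = 0"
    if "f \<in> fspan F9" "\<And>\<psi> \<phi>. norm \<psi> = 1 \<Longrightarrow> norm \<phi> = 1 \<Longrightarrow> f (ray_of (tensor \<psi> \<phi>)) = 0" for f
    by (rule zero_if_zero_on_product_states[OF assms(5,10,13) B assms(13) B])
      (use that span9 in auto)
  \<comment> \<open>The first four entries form a 2 by 2 block of the coefficient matrix;
    \<open>c\<close> shares neither a row nor a column with it.\<close>
  define i j k l c :: "3 \<times> 3" where
    "i = (1, 1)" and "j = (1, 2)" and "k = (2, 1)" and "l = (2, 2)" and "c = (3, 3)"
  note index_defs = i_def j_def k_def l_def c_def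
  have neq: "i \<noteq> j" "i \<noteq> k" "i \<noteq> l" "j \<noteq> k" "j \<noteq> l" "k \<noteq> l" "c \<notin> {i, j, k, l}"
    by (simp_all add: index_defs)
  obtain P where P: "polynomial_kernel_space (fspan F9) P"
    "fspan F9 = fspan ((\<lambda>x r. poly P ((norm (cip x (vec_of r)))\<^sup>2)) ` {x. norm x = 1})"
    using fspan_polynomial_kernel[OF assms(2,7,12) neq(1,2,4)] by blast
  interpret polynomial_kernel_space "fspan F9" P by (rule P(1))
  obtain n where n: "degree P = Suc (Suc n)"
    using degree_ge_2_if_alternative[OF assms(4) P(2)] by (metis add_2_eq_Suc le_Suc_ex)
  define D :: "complex^(3 \<times> 3) \<Rightarrow> complex" where
    "D v = v$i ^ n * (v$j * v$k - v$i * v$l) * cnj (v$c) ^ Suc (Suc n)" for v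
  have mem: "(\<lambda>r. Re (D (vec_of r))) \<in> fspan F9" "(\<lambda>r. Im (D (vec_of r))) \<in> fspan F9"
    using determinant_mem[OF n neq(7)] by (simp_all add: complexification_def Let_def D_def)
  have "D (vec_of (ray_of (tensor \<psi> \<phi>))) = 0" if "norm \<psi> = 1" "norm \<phi> = 1" for \<psi> \<phi> :: "complex^3"
  proof -
    have "norm (tensor \<psi> \<phi>) = 1" by (simp add: norm_tensor that)
    then obtain z where z: "vec_of (ray_of (tensor \<psi> \<phi>)) = z *s tensor \<psi> \<phi>"
      using vec_of_ray_of_phase by blast
    \<comment> \<open>Both products in the minor of a product vector equal
      \<open>\<psi>$1 * \<psi>$2 * \<phi>$1 * \<phi>$2\<close>.\<close>
    show ?thesis unfolding D_def z by (simp add: tensor_def index_defs)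
  qed
  then have "(\<lambda>r. Re (D (vec_of r))) = 0" "(\<lambda>r. Im (D (vec_of r))) = 0"
    by (intro local_tomography mem; simp)+
  then have D0: "D (vec_of r) = 0" for r by (simp add: fun_eq_iff complex_eq_iff)
  \<comment> \<open>The maximally entangled vector: its \<open>j\<close> entry is 0, so the minor
    reduces to minus the product of two nonzero diagonal entries, and its \<open>c\<close> entry is
    nonzero too.\<close>
  define x :: "complex^(3 \<times> 3)" where
    "x = of_real (1 / sqrt 3) *s (axis i 1 + axis l 1 + axis c 1)"
  have x: "x$i = of_real (1 / sqrt 3)" "x$l = of_real (1 / sqrt 3)" "x$c = of_real (1 / sqrt 3)" "x$j = 0"
    using neq by (auto simp: x_def axis_def)
  have "cip x x = 1"
  proof -
    have "cip x x = of_real (1 / sqrt 3) * (x$i + x$l + x$c)"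
      unfolding x_def cip_scale_left cip_add_left cip_axis by simp
    also have "\<dots> = of_real (1 / sqrt 3 * (1 / sqrt 3 + 1 / sqrt 3 + 1 / sqrt 3))"
      by (simp only: x of_real_add of_real_mult)
    also have "1 / sqrt 3 * (1 / sqrt 3 + 1 / sqrt 3 + 1 / sqrt 3) = (1::real)" by (simp add: field_simps)
    finally show ?thesis by simp
  qed
  then have "norm x = 1" by (rule norm_1_if_cip)
  then obtain z where z: "z \<noteq> 0" "vec_of (ray_of x) = z *s x" using vec_of_ray_of_phase by blast
  have "D (z *s x) \<noteq> 0" using z(1) by (simp add: D_def x)
  with D0[of "ray_of x"] z(2) show False by simp
qed

end
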